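(* Let $p>1$ and $T>0$. For $\lambda\ge1$ and $x\in C([0,T];\mathbb R)$ let $(R_\lambda x)(t):=\lambda^{1/p}x(t/\lambda)$, $t\in[0,T]$, and for a continuous nondecreasing $A:[0,T]\to[0,\infty)$ with $A(0)=0$ let $A_\lambda(t):=\lambda A(t/\lambda)$. (i) $R_\lambda R_\mu=R_{\lambda\mu}$ for $\lambda,\mu\ge1$, and for every $\lambda\ge1$, every $x\in C([0,T])$, every shifted uniform grid $\Pi(\ell,a)$ on $[0,T]$ and every $t\in[0,T]$, $$\mathsf V^p_{\Pi(\ell,a)}(R_\lambda x;t)=\lambda\,\mathsf V^p_{\Pi(\ell/\lambda,a/\lambda)}(x;t/\lambda).$$ Consequently, for every continuous nondecreasing $A$ with $A(0)=0$, $\Omega_p^{A_\lambda}(R_\lambda x;\delta)\le\lambda\,\Omega_p^A(x;\delta/\lambda)$ for $0<\delta\le T$. (ii) If $x\in\mathscr R_p^+([0,T])$ with intrinsic energy $A=[x]^p$, then for every $\lambda\ge1$, $R_\lambda x\in\mathscr R_p^+([0,T])$ and $[R_\lambda x]^p=A_\lambda$. More generally, for $x\in\mathscr R_p([0,T])$ with intrinsic energy $A$ and a fixed $\lambda\ge1$, $R_\lambda x\in\mathscr R_p([0,T])$ if and only if $A(T/\lambda)>0$, and in that case $[R_\lambda x]^p=A_\lambda$. (iii) For a continuous nondecreasing $A$ with $A(0)=0$: $A_\lambda=A$ for all $\lambda\ge1$ if and only if $A(t)=A(T)\,t/T$ for all $t\in[0,T]$. Hence the $p$-rough paths whose intrinsic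 energy is invariant under the flow $(A\mapsto A_\lambda)_{\lambda\ge1}$ are exactly those with linear intrinsic energy. (iv) Let $x\in\mathscr R_p([0,T])$ with intrinsic energy $A$. If $\alpha:=\lim_{s\downarrow0}A(s)/s$ exists and lies in $(0,\infty)$, then $x\in\mathscr R_p^+([0,T])$, $R_\lambda x\in\mathscr R_p^+([0,T])$ for every $\lambda\ge1$, and $\sup_{t\in[0,T]}|[R_\lambda x]^p(t)-\alpha t|\to0$ as $\lambda\to\infty$. (v) For $\gamma>0$ let $(R_\lambda^{(\gamma)}x)(t):=\lambda^\gamma x(t/\lambda)$. Under the hypotheses of (iv), $R_\lambda^{(\gamma)}x\in\mathscr R_p([0,T])$ with intrinsic energy $\lambda^{\gamma p-1}A_\lambda$, which as $\lambda\to\infty$ converges uniformly on $[0,T]$ to $\alpha t$ if $\gamma=1/p$, to $0$ if $\gamma<1/p$, and diverges at every $t>0$ if $\gamma>1/p$. (vi) Let $x\in\mathscr R_p([0,T])$ and $z\in C([0,T])$. For $\beta\in(0,1]$ let $K_\beta(z):=\sup_{s\ne t}|z(t)-z(s)|/|t-s|^\beta$. (a) If $K_\beta(z)<\infty$ for some $\beta\in(1/p,1]$, then for all $\lambda\ge1$ and $\delta\in(0,T]$, $$\sup_{0<\ell\le\delta}\sup_{0\le a<\ell}\sup_{t\in[0,T]}\mathsf V^p_{\Pi(\ell,a)}(R_\lambda z;t)\le K_\beta(z)^p\,(T+2\delta)\,\delta^{\beta p-1}\,\lambda^{1-\beta p},$$ and $x+z\in\mathscr R_p([0,T])$ with $[x+z]^p=[x]^p$.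 (b) If $z\in\mathscr R_q([0,T])$ with $q>p$, then $x+z\in\mathscr R_q([0,T])$ with $[x+z]^q=[z]^q$, and $\inf_{0\le a<\ell}\mathsf V^{p'}_{\Pi(\ell,a)}(x+z;T)\to\infty$ as $\ell\downarrow0$ for every $1<p'<q$; in particular $x+z\notin\mathscr R_p([0,T])$.
   Context: Stopped $p$-energy: for a finite partition $\lambda=\{0=u_0<\dots<u_N=T\}$ and $t\in[0,T]$, $\mathsf V^p_\lambda(x;t):=\sum_{i=0}^{N-1}|x(u_{i+1}\wedge t)-x(u_i\wedge t)|^p$. Shifted uniform grids on $[0,T]$: for $0<\ell\le T$, $0\le a<\ell$, $\Pi(\ell,a):=\{0,T\}\cup\{a+k\ell: k\in\mathbb Z,\ 0<a+k\ell<T\}$. $\Omega^A_p(x;\delta):=\sup_{0<\ell\le\delta}\sup_{0\le a<\ell}\sup_{t\in[0,T]}|\mathsf V^p_{\Pi(\ell,a)}(x;t)-A(t)|$. $\mathscr R_p([0,T])$ is the class of $p$-rough paths: $x\in C([0,T];\mathbb R)$ such that $\Omega_p^A(x;\delta)\to0$ as $\delta\downarrow0$ for some continuous nondecreasing $A:[0,T]\to[0,\infty)$ with $A(T)>A(0)=0$; $A$ is then unique, is called the intrinsic energy of $x$, and is denoted $[x]^p$. $\mathscr R_p^+([0,T])$ is the set of $x\in\mathscr R_p([0,T])$ with $[x]^p(t)>0$ for all $t\in(0,T]$. *)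

theory Defs
  imports "HOL-Analysis.Analysis"
begin

text \<open>
  Paths and energies on $[0,T]$ are total functions on the reals of which only the values on
  \<open>{0..T}\<close> matter; suprema that may be infinite are taken in \<^typ>\<open>ereal\<close>.
\<close>

definition stopped_energy :: "real \<Rightarrow> real set \<Rightarrow> (real \<Rightarrow> real) \<Rightarrow> real \<Rightarrow> real" where
  "stopped_energy p P x t =
     (let u = sorted_list_of_set P in
        \<Sum>i<length u - 1. \<bar>x (min (u ! (i + 1)) t) - x (min (u ! i) t)\<bar> powr p)"

definition shifted_grid :: "real \<Rightarrow> real \<Rightarrow> real \<Rightarrow> real set" where
  "shifted_grid T h a =
     {0, T} \<union> {u. \<exists>k::int. u = a + of_int k * h \<and> 0 < u \<and> u < T}"

text \<open>Only used for \<open>\<delta> \<le> T\<close> or in the limit \<open>\<delta> \<down> 0\<close>, so all meshes \<open>h\<close> satisfy \<open>h \<le> T\<close>.\<close>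

definition energy_modulus ::
    "real \<Rightarrow> real \<Rightarrow> (real \<Rightarrow> real) \<Rightarrow> (real \<Rightarrow> real) \<Rightarrow> real \<Rightarrow> ereal" where
  "energy_modulus p T A x \<delta> =
     (SUP h\<in>{0<..\<delta>}. SUP a\<in>{0..<h}. SUP t\<in>{0..T}.
        ereal \<bar>stopped_energy p (shifted_grid T h a) x t - A t\<bar>)"

definition energy_profile :: "real \<Rightarrow> (real \<Rightarrow> real) \<Rightarrow> bool" where
  "energy_profile T A \<longleftrightarrow>
     continuous_on {0..T} A \<and> mono_on {0..T} A \<and> (\<forall>t\<in>{0..T}. 0 \<le> A t) \<and> A 0 = 0"

definition is_intrinsic_energy :: "real \<Rightarrow> real \<Rightarrow> (real \<Rightarrow> real) \<Rightarrow> (real \<Rightarrow> real) \<Rightarrow> bool" where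
  "is_intrinsic_energy p T x A \<longleftrightarrow>
     energy_profile T A \<and> 0 < A T \<and> (energy_modulus p T A x \<longlongrightarrow> 0) (at_right 0)"

definition rough_paths :: "real \<Rightarrow> real \<Rightarrow> (real \<Rightarrow> real) set" where
  "rough_paths p T = {x. continuous_on {0..T} x \<and> (\<exists>A. is_intrinsic_energy p T x A)}"

text \<open>
  The intrinsic energy is unique as a function on \<open>{0..T}\<close>; \<^const>\<open>extensional\<close> fixes the
  irrelevant values outside.
\<close>

definition intrinsic_energy :: "real \<Rightarrow> real \<Rightarrow> (real \<Rightarrow> real) \<Rightarrow> real \<Rightarrow> real" where
  "intrinsic_energy p T x = (THE A. A \<in> extensional {0..T} \<and> is_intrinsic_energy p T x A)"

definition pos_rough_paths :: "real \<Rightarrow> real \<Rightarrow> (real \<Rightarrow> real) set" where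
  "pos_rough_paths p T = {x \<in> rough_paths p T. \<forall>t\<in>{0<..T}. 0 < intrinsic_energy p T x t}"

text \<open>The flow \<open>R\<^sub>l\<close> is the case \<open>\<gamma> = 1/p\<close>.\<close>

definition rescale :: "real \<Rightarrow> real \<Rightarrow> (real \<Rightarrow> real) \<Rightarrow> real \<Rightarrow> real" where
  "rescale \<gamma> l x t = l powr \<gamma> * x (t / l)"

definition rescale_energy :: "real \<Rightarrow> (real \<Rightarrow> real) \<Rightarrow> real \<Rightarrow> real" where
  "rescale_energy l A t = l * A (t / l)"

definition hoelder_const :: "real \<Rightarrow> real \<Rightarrow> (real \<Rightarrow> real) \<Rightarrow> ereal" where
  "hoelder_const T \<beta> z =
     (SUP (s, t) \<in> {(s, t). s \<in> {0..T} \<and> t \<in> {0..T} \<and> s \<noteq> t}.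
        ereal (\<bar>z t - z s\<bar> / \<bar>t - s\<bar> powr \<beta>))"

text \<open>The definite description in \<^const>\<open>intrinsic_energy\<close> is well defined.\<close>

lemma energy_modulus_upper:
  assumes "0 < \<delta>" "t \<in> {0..T}"
  shows "ereal \<bar>stopped_energy p (shifted_grid T \<delta> 0) x t - A t\<bar> \<le> energy_modulus p T A x \<delta>"
  unfolding energy_modulus_def
  by (rule SUP_upper2[of \<delta>], use assms in simp, rule SUP_upper2[of 0], use assms in simp,
      rule SUP_upper2[of t], use assms in simp_all)

lemma is_intrinsic_energy_LIM:
  assumes "is_intrinsic_energy p T x A" "t \<in> {0..T}"
  shows "((\<lambda>h. stopped_energy p (shifted_grid T h 0) x t) \<longlongrightarrow> A t) (at_right 0)"
proof -
  have "((\<lambda>h. ereal \<bar>stopped_energy p (shifted_grid T h 0) x t - A t\<bar>) \<longlongrightarrow> 0) (at_right 0)"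
  proof (rule tendsto_sandwich[OF _ _ tendsto_const])
    show "(energy_modulus p T A x \<longlongrightarrow> 0) (at_right 0)"
      using assms(1) by (simp add: is_intrinsic_energy_def)
    show "\<forall>\<^sub>F h in at_right 0. ereal \<bar>stopped_energy p (shifted_grid T h 0) x t - A t\<bar>
            \<le> energy_modulus p T A x h"
      by (rule eventually_at_right_less[THEN eventually_mono])
         (rule energy_modulus_upper[OF _ assms(2)])
  qed auto
  then have "((\<lambda>h. \<bar>stopped_energy p (shifted_grid T h 0) x t - A t\<bar>) \<longlongrightarrow> 0) (at_right 0)"
    by (simp add: zero_ereal_def)
  then show ?thesis
    by (simp add: tendsto_rabs_zero_iff LIM_zero_iff)
qed

lemma is_intrinsic_energy_unique:
  assumes "is_intrinsic_energy p T x A" "is_intrinsic_energy p T x B" "t \<in> {0..T}"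
  shows "A t = B t"
  using is_intrinsic_energy_LIM[OF assms(1,3)] is_intrinsic_energy_LIM[OF assms(2,3)]
  by (rule tendsto_unique[rotated]) simp

lemma is_intrinsic_energy_cong:
  assumes "\<And>t. t \<in> {0..T} \<Longrightarrow> A t = B t" "0 \<le> T" "is_intrinsic_energy p T x A"
  shows "is_intrinsic_energy p T x B"
proof -
  have "energy_modulus p T A x = energy_modulus p T B x"
    unfolding energy_modulus_def by (intro ext SUP_cong refl) (simp add: assms(1))
  moreover have "continuous_on {0..T} A \<longleftrightarrow> continuous_on {0..T} B"
    by (rule continuous_on_cong) (auto simp: assms(1))
  then have "energy_profile T B"
    using assms unfolding is_intrinsic_energy_def energy_profile_def mono_on_def
    by auto
  ultimately show ?thesis
    using assms(3) assms(1)[of T] \<open>0 \<le> T\<close> by (simp add: is_intrinsic_energy_def)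
qed

lemma intrinsic_energy_eqI:
  assumes "is_intrinsic_energy p T x A" "0 \<le> T" "t \<in> {0..T}"
  shows "intrinsic_energy p T x t = A t"
proof -
  have "intrinsic_energy p T x = restrict A {0..T}"
    unfolding intrinsic_energy_def
  proof (rule the_equality)
    show "restrict A {0..T} \<in> extensional {0..T} \<and> is_intrinsic_energy p T x (restrict A {0..T})"
      using is_intrinsic_energy_cong[OF _ assms(2,1)] by simp
  next
    fix B assume "B \<in> extensional {0..T} \<and> is_intrinsic_energy p T x B"
    then show "B = restrict A {0..T}"
      using is_intrinsic_energy_unique[OF _ assms(1)]
      by (intro extensionalityI[of _ "{0..T}"]) auto
  qed
  then show ?thesis using assms(3) by simp
qed

end

theory Submission imports Defs "HOL-Real_Asymp.Real_Asymp" begin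

text \<open>
  The energy along a shifted grid stopped at \<open>t\<close> is the sum of the \<open>p\<close>-th powers of the increments of
  \<open>x\<close> over the arithmetic progression \<open>a + k h\<close> clipped to \<open>[0, t]\<close>. Clipping commutes with dilations, so
  rescaling the path only rescales the grid, and the energy of the rescaled path is the rescaled energy;
  the remaining assertions about the flow concern the behaviour of \<open>A(s)/s\<close> at 0. For perturbations,
  convexity gives \<open>V(x + z) \<le> \<theta>\<^sup>1\<^sup>-\<^sup>p V(x) + (1 - \<theta>)\<^sup>1\<^sup>-\<^sup>p V(z)\<close>, so that a path whose
  energies vanish uniformly does not affect the intrinsic energy. Energies of Hoelder paths with exponent
  above \<open>1/p\<close> vanish because the increments of the clipped grid telescope, and
  \<open>V\<^sup>q \<le> osc\<^sup>q\<^sup>-\<^sup>p V\<^sup>p\<close> both kills the \<open>q\<close>-energy of a \<open>p\<close>-rough path and forces the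
  \<open>p\<close>-energy of a \<open>q\<close>-rough path to explode when \<open>p < q\<close>.
\<close>

subsection \<open>Energies along shifted grids\<close>

text \<open>Equal neighbours contribute \<open>g c c = 0\<close>, so repetitions in a sorted list do
  not change the sum. The energy is defined through \<open>sorted_list_of_set\<close>, whereas a
  progression clipped to an interval repeats its endpoints.\<close>

lemma sum_consecutive_sorted_list_of_set:
  fixes g :: "'a::linorder \<Rightarrow> 'a \<Rightarrow> 'b::comm_monoid_add"
  assumes "sorted w" and "\<And>c. g c c = 0"
  shows "(let u = sorted_list_of_set (set w) in \<Sum>i<length u - 1. g (u ! i) (u ! (i + 1)))
         = (\<Sum>i<length w - 1. g (w ! i) (w ! (i + 1)))"
  using assms(1)
proof (induction w)
  case Nil
  then show ?case by simp
next
  case (Cons b w)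
  \<comment> \<open>Prepending \<open>c\<close> adds one pair, or none if \<open>v\<close> is empty
    and has no head.\<close>
  have step: "(\<Sum>i<length (c # v) - 1. g ((c # v) ! i) ((c # v) ! (i + 1)))
      = (if v = [] then 0 else g c (hd v)) + (\<Sum>i<length v - 1. g (v ! i) (v ! (i + 1)))" for c v
    by (cases v) (simp_all add: sum.lessThan_Suc_shift del: sum.lessThan_Suc)
  have head: "hd w = Min (set w)" if "w \<noteq> []"
    using Cons.prems that by (cases w) (auto intro!: Min_eqI[symmetric])
  show ?case
  proof (cases "b \<in> set w")
    case True
    then have "w \<noteq> []" by auto
    \<comment> \<open>A repeated \<open>b\<close> is a least entry of \<open>w\<close>, hence its
      head, so the added pair is \<open>g b b\<close>.\<close>
    with True Cons.prems have "hd w = b"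
      by (cases w) auto
    with True \<open>w \<noteq> []\<close> Cons show ?thesis
      unfolding step by (simp add: insert_absorb assms(2))
  next
    case False
    let ?u = "sorted_list_of_set (set w)"
    have u: "sorted_list_of_set (set (b # w)) = b # ?u"
      unfolding list.set(2) using Cons.prems False
      by (intro sorted_list_of_set_unique[THEN iffD1]) (auto simp: strict_sorted_iff order_less_le)
    have IH: "(\<Sum>i<length ?u - 1. g (?u ! i) (?u ! (i + 1)))
        = (\<Sum>i<length w - 1. g (w ! i) (w ! (i + 1)))"
      using Cons unfolding Let_def by simp
    have "?u = [] \<longleftrightarrow> w = []" by simp
    moreover have "hd ?u = hd w" if "w \<noteq> []"
      using that head by (simp add: sorted_list_of_set_nonempty)
    ultimately show ?thesis
      unfolding Let_def u step IH by simp
  qed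
qed

text \<open>
  The index is shifted so that, for \<open>0 \<le> a < h\<close>, point 0 is the time 0. Repeated endpoints are
  harmless: they contribute \<open>0 powr p = 0\<close> to the energy.
\<close>

definition clipped_point :: "real \<Rightarrow> real \<Rightarrow> real \<Rightarrow> nat \<Rightarrow> real" where
  "clipped_point h a t k = max 0 (min (a + (real k - 1) * h) t)"

lemma clipped_point_mono: "0 \<le> h \<Longrightarrow> i \<le> j \<Longrightarrow> clipped_point h a t i \<le> clipped_point h a t j"
  unfolding clipped_point_def by (intro max.mono min.mono add_left_mono mult_right_mono) auto

lemma clipped_point_0: "a < h \<Longrightarrow> clipped_point h a t 0 = 0"
  by (simp add: clipped_point_def)

lemma clipped_point_last:
  assumes "0 \<le> h" "0 \<le> t" "t \<le> a + (real n - 1) * h" "n \<le> k"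
  shows "clipped_point h a t k = t"
proof -
  have "(real n - 1) * h \<le> (real k - 1) * h"
    using assms by (intro mult_right_mono) auto
  with assms show ?thesis by (simp add: clipped_point_def)
qed

text \<open>The progression starts at \<open>a - h < 0\<close> and reaches \<open>T\<close> by index
  \<open>m\<close>. Clipping therefore produces both endpoints and leaves the points strictly
  between them unchanged.\<close>

lemma shifted_grid_eq_image:
  assumes "0 < h" "0 \<le> a" "a < h" "0 \<le> T" "T \<le> a + (real m - 1) * h"
  shows "shifted_grid T h a = clipped_point h a T ` {..m}"
proof (intro equalityI subsetI)
  fix u assume "u \<in> shifted_grid T h a"
  then consider "u = 0" | "u = T" | k :: int where "u = a + of_int k * h" "0 < u" "u < T"
    by (auto simp: shifted_grid_def)
  then show "u \<in> clipped_point h a T ` {..m}"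
  proof cases
    case 1
    with assms show ?thesis by (intro image_eqI[of _ _ 0]) (simp_all add: clipped_point_0)
  next
    case 2
    with assms show ?thesis by (intro image_eqI[of _ _ m]) (simp_all add: clipped_point_last[of _ _ _ m])
  next
    case 3
    \<comment> \<open>The interior point with multiplier \<open>k\<close> gets index
      \<open>k + 1\<close>; negative \<open>k\<close> is excluded by \<open>a < h\<close>, since the
      point is positive and below \<open>(k + 1) * h\<close>.\<close>
    have "0 < (of_int k + 1) * h"
      using 3 assms by (simp add: algebra_simps)
    then have "0 \<le> k" using assms(1) by (simp add: zero_less_mult_iff)
    have "of_int k * h < (real m - 1) * h" using 3 assms by linarith
    then have "k + 1 < int m" using assms(1) by simp
    show ?thesis
      using 3 \<open>0 \<le> k\<close> \<open>k + 1 < int m\<close>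
      by (intro image_eqI[of _ _ "nat (k + 1)"]) (auto simp: clipped_point_def algebra_simps)
  qed
next
  fix u assume "u \<in> clipped_point h a T ` {..m}"
  then obtain k where u: "u = clipped_point h a T k" by auto
  show "u \<in> shifted_grid T h a"
  proof (cases "u = 0 \<or> u = T")
    case True
    then show ?thesis by (auto simp: shifted_grid_def)
  next
    case False
    with u have "u = a + of_int (int k - 1) * h \<and> 0 < u \<and> u < T"
      by (auto simp: clipped_point_def max_def min_def split: if_splits)
    then show ?thesis unfolding shifted_grid_def by blast
  qed
qed

text \<open>Clipping to \<open>[0, T]\<close> and then stopping at \<open>t \<le> T\<close> amounts
  to clipping to \<open>[0, t]\<close>, and the summands vanish once the progression has reached
  \<open>t\<close>. Hence every sufficiently large \<open>n\<close> is admissible and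
  \<open>T\<close> disappears from the sum.\<close>

lemma stopped_energy_shifted_grid:
  assumes "0 < h" "0 \<le> a" "a < h" "0 \<le> t" "t \<le> T" "t \<le> a + (real n - 1) * h"
  shows "stopped_energy p (shifted_grid T h a) x t =
    (\<Sum>k<n. \<bar>x (clipped_point h a t (Suc k)) - x (clipped_point h a t k)\<bar> powr p)"
proof -
  obtain j where j: "T / h \<le> real j" using real_arch_simple by blast
  \<comment> \<open>The enumeration must reach \<open>T\<close>, possibly far beyond
    \<open>t\<close>; for indices from \<open>n\<close> on, both clipped points equal
    \<open>t\<close> and the extra terms are zero.\<close>
  define m where "m = max n (j + 1)"
  have "T \<le> real j * h" using j assms(1) by (simp add: field_simps)
  also have "\<dots> \<le> (real m - 1) * h" using assms(1) by (intro mult_right_mono) (auto simp: m_def)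
  finally have m: "T \<le> a + (real m - 1) * h" using assms(2) by simp
  define w where "w = map (clipped_point h a T) [0..<Suc m]"
  have w: "sorted w" "set w = shifted_grid T h a"
    unfolding w_def sorted_iff_nth_mono using assms m
    by (auto simp: shifted_grid_eq_image atLeast0LessThan lessThan_Suc_atMost simp del: upt_Suc intro: clipped_point_mono)
  have clip: "min (clipped_point h a T k) t = clipped_point h a t k" for k
    using assms by (auto simp: clipped_point_def)
  have "stopped_energy p (shifted_grid T h a) x t =
      (\<Sum>i<length w - 1. \<bar>x (min (w ! (i + 1)) t) - x (min (w ! i) t)\<bar> powr p)"
    unfolding stopped_energy_def w(2)[symmetric]
    using sum_consecutive_sorted_list_of_set[OF w(1),
        of "\<lambda>c d. \<bar>x (min d t) - x (min c t)\<bar> powr p"] by simp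
  also have "\<dots> = (\<Sum>k<m. \<bar>x (clipped_point h a t (Suc k)) - x (clipped_point h a t k)\<bar> powr p)"
    by (rule sum.cong) (auto simp: w_def clip simp del: upt_Suc)
  also have "\<dots> = (\<Sum>k<n. \<bar>x (clipped_point h a t (Suc k)) - x (clipped_point h a t k)\<bar> powr p)"
    using assms by (intro sum.mono_neutral_right) (auto simp: m_def clipped_point_last[of _ _ _ n])
  finally show ?thesis .
qed

lemma clipped_points_reach:
  assumes "0 < h" "0 \<le> a"
  obtains n where "(t::real) \<le> a + (real n - 1) * h"
proof -
  obtain j where "t / h \<le> real j" using real_arch_simple by blast
  then have "t \<le> a + (real (Suc j) - 1) * h" using assms by (simp add: field_simps)
  then show thesis by (rule that)
qed

text \<open>Replaces the grid by a nondecreasing chain from \<open>0\<close> to \<open>t\<close>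
  with steps at most \<open>h\<close>. The chain does not depend on \<open>p\<close> and
  \<open>x\<close>, so energies with different exponents can be compared term by term.\<close>

lemma stopped_energy_grid_points:
  assumes "0 < h" "a \<in> {0..<h}" "t \<in> {0..T}"
  obtains n :: nat and c :: "nat \<Rightarrow> real"
  where "\<And>p x. stopped_energy p (shifted_grid T h a) x t = (\<Sum>k<n. \<bar>x (c (Suc k)) - x (c k)\<bar> powr p)"
    and "c 0 = 0" "c n = t" "\<And>k. c k \<in> {0..t}" "\<And>k. c k \<le> c (Suc k)" "\<And>k. c (Suc k) - c k \<le> h"
proof -
  obtain n where n: "t \<le> a + (real n - 1) * h"
    using clipped_points_reach[of h a t] assms by auto
  have "clipped_point h a t (Suc k) - clipped_point h a t k \<le> h" for k
    using assms by (auto simp: clipped_point_def algebra_simps max_def min_def)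
  moreover have "clipped_point h a t k \<in> {0..t}" for k
    using assms by (auto simp: clipped_point_def)
  ultimately show thesis
    using assms n by (intro that[where n = n and c = "clipped_point h a t"] stopped_energy_shifted_grid)
      (auto simp: clipped_point_last clipped_point_0 intro: clipped_point_mono)
qed

text \<open>The same \<open>n\<close> serves both grids and their clipped points differ by the
  factor \<open>l\<close>, so the two sums correspond term by term. The amplitude
  \<open>l powr (1/p)\<close> becomes \<open>l\<close> under the \<open>p\<close>-th power.\<close>

lemma stopped_energy_rescale:
  assumes "0 < l" "0 < h" "a \<in> {0..<h}" "t \<in> {0..T}" "t / l \<le> T" "p \<noteq> 0"
  shows "stopped_energy p (shifted_grid T h a) (rescale (1/p) l x) t
           = l * stopped_energy p (shifted_grid T (h / l) (a / l)) x (t / l)"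
proof -
  obtain n where n: "t \<le> a + (real n - 1) * h"
    using clipped_points_reach[of h a t] assms by auto
  have clip: "clipped_point (h / l) (a / l) (t / l) k = clipped_point h a t k / l" for k
    using assms(1) by (simp add: clipped_point_def max_divide_distrib_right min_divide_distrib_right
        add_divide_distrib)
  have "t / l \<le> a / l + (real n - 1) * (h / l)"
    using n assms(1) by (simp add: field_simps)
  then have "stopped_energy p (shifted_grid T (h / l) (a / l)) x (t / l)
      = (\<Sum>k<n. \<bar>x (clipped_point h a t (Suc k) / l) - x (clipped_point h a t k / l)\<bar> powr p)"
    using assms by (subst stopped_energy_shifted_grid[where n = n]) (auto simp: clip divide_strict_right_mono)
  moreover have "\<bar>l powr (1/p) * u - l powr (1/p) * v\<bar> powr p = l * \<bar>u - v\<bar> powr p" for u v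
    using assms by (simp add: abs_mult powr_mult powr_powr flip: right_diff_distrib)
  ultimately show ?thesis
    using assms n by (subst stopped_energy_shifted_grid[where n = n]) (auto simp: rescale_def sum_distrib_left)
qed

subsection \<open>Inequalities for stopped energies\<close>

lemma stopped_energy_nonneg: "0 \<le> stopped_energy p P x t"
  unfolding stopped_energy_def Let_def by (intro sum_nonneg) simp

lemma stopped_energy_uminus: "stopped_energy p P (\<lambda>s. - x s) t = stopped_energy p P x t"
  unfolding stopped_energy_def Let_def by (intro sum.cong) (auto simp: abs_minus_commute)

lemma stopped_energy_cmult:
  "stopped_energy p P (\<lambda>s. c * x s) t = \<bar>c\<bar> powr p * stopped_energy p P x t"
  unfolding stopped_energy_def Let_def sum_distrib_left
  by (intro sum.cong) (auto simp: abs_mult powr_mult simp flip: right_diff_distrib)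

text \<open>
  Used with \<open>\<theta>\<close> close to 1 in place of Minkowski's inequality.
\<close>

lemma powr_abs_add_le:
  fixes u v :: real
  assumes "1 \<le> p" "0 < \<theta>" "\<theta> < 1"
  shows "\<bar>u + v\<bar> powr p \<le> \<theta> powr (1 - p) * \<bar>u\<bar> powr p + (1 - \<theta>) powr (1 - p) * \<bar>v\<bar> powr p"
proof -
  have weight: "1 \<le> s powr (1 - p)" if "0 < s" "s < 1" for s :: real
    using powr_mono'[of "1 - p" 0 s] that assms(1) by simp
  have cancel: "s * (w / s) powr p = s powr (1 - p) * w powr p" if "0 < s" "0 \<le> w" for s w :: real
    using that by (simp add: powr_divide powr_diff field_simps)
  \<comment> \<open>Convexity is applied at positive arguments only; if one summand is zero, the
    bound holds because both weights are at least 1.\<close>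
  consider "u = 0" | "v = 0" | "u \<noteq> 0" "v \<noteq> 0" by blast
  then show ?thesis
  proof cases
    case 1
    with weight[of "1 - \<theta>"] assms show ?thesis by (simp add: mult_le_cancel_right1)
  next
    case 2
    with weight[of \<theta>] assms show ?thesis by (simp add: mult_le_cancel_right1)
  next
    case 3
    have "\<bar>u + v\<bar> powr p \<le> (\<bar>u\<bar> + \<bar>v\<bar>) powr p"
      using assms by (intro powr_mono2) auto
    \<comment> \<open>Writes the sum as a convex combination with weights \<open>\<theta>\<close>
      and \<open>1 - \<theta>\<close>; \<open>cancel\<close> then converts the resulting bound to
      the stated weights.\<close>
    also have "\<bar>u\<bar> + \<bar>v\<bar> = (1 - (1 - \<theta>)) *\<^sub>R (\<bar>u\<bar> / \<theta>) + (1 - \<theta>) *\<^sub>R (\<bar>v\<bar> / (1 - \<theta>))"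
      using assms by simp
    also have "\<dots> powr p \<le> (1 - (1 - \<theta>)) * (\<bar>u\<bar> / \<theta>) powr p + (1 - \<theta>) * (\<bar>v\<bar> / (1 - \<theta>)) powr p"
      using assms 3 by (intro convex_onD[OF powr_convex]) auto
    finally show ?thesis using assms by (simp add: cancel)
  qed
qed

lemma stopped_energy_add_le:
  assumes "1 \<le> p" "0 < \<theta>" "\<theta> < 1"
  shows "stopped_energy p P (\<lambda>s. x s + z s) t
    \<le> \<theta> powr (1 - p) * stopped_energy p P x t + (1 - \<theta>) powr (1 - p) * stopped_energy p P z t"
  unfolding stopped_energy_def Let_def sum_distrib_left sum.distrib[symmetric]
proof (rule sum_mono)
  fix i
  let ?u = "sorted_list_of_set P"
  show "\<bar>x (min (?u ! (i + 1)) t) + z (min (?u ! (i + 1)) t) - (x (min (?u ! i) t) + z (min (?u ! i) t))\<bar> powr p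
    \<le> \<theta> powr (1 - p) * \<bar>x (min (?u ! (i + 1)) t) - x (min (?u ! i) t)\<bar> powr p
      + (1 - \<theta>) powr (1 - p) * \<bar>z (min (?u ! (i + 1)) t) - z (min (?u ! i) t)\<bar> powr p"
    using powr_abs_add_le[OF assms, of "x (min (?u ! (i + 1)) t) - x (min (?u ! i) t)"
        "z (min (?u ! (i + 1)) t) - z (min (?u ! i) t)"]
    by (simp add: algebra_simps)
qed

text \<open>In each term, \<open>q - p\<close> powers of the increment are bounded by the
  oscillation over one mesh. The estimate serves in both directions: as an upper bound for the
  \<open>q\<close>-energy and as a lower bound for the \<open>p\<close>-energy.\<close>

lemma stopped_energy_le_exponent:
  assumes "0 < h" "a \<in> {0..<h}" "t \<in> {0..T}" "p < q"
    and osc: "\<And>s u. s \<in> {0..T} \<Longrightarrow> u \<in> {0..T} \<Longrightarrow> \<bar>u - s\<bar> \<le> h \<Longrightarrow> \<bar>x u - x s\<bar> \<le> \<epsilon>"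
  shows "stopped_energy q (shifted_grid T h a) x t
    \<le> \<epsilon> powr (q - p) * stopped_energy p (shifted_grid T h a) x t"
proof -
  obtain n c where V: "\<And>p x. stopped_energy p (shifted_grid T h a) x t
        = (\<Sum>k<n. \<bar>x (c (Suc k)) - x (c k)\<bar> powr p)"
    and "c 0 = 0" "c n = t"
    and c: "\<And>k. c k \<in> {0..t}" "\<And>k. c k \<le> c (Suc k)" "\<And>k. c (Suc k) - c k \<le> h"
    by (rule stopped_energy_grid_points[OF assms(1-3)]) (rule that)
  show ?thesis
    unfolding V sum_distrib_left
  proof (rule sum_mono)
    fix k
    have "\<bar>x (c (Suc k)) - x (c k)\<bar> \<le> \<epsilon>"
      using c(1)[of k] c(1)[of "Suc k"] c(2,3)[of k] assms(3) by (intro osc) auto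
    then have d: "\<bar>x (c (Suc k)) - x (c k)\<bar> powr (q - p) \<le> \<epsilon> powr (q - p)"
      using assms(4) by (intro powr_mono2) auto
    show "\<bar>x (c (Suc k)) - x (c k)\<bar> powr q
        \<le> \<epsilon> powr (q - p) * \<bar>x (c (Suc k)) - x (c k)\<bar> powr p"
      using mult_right_mono[OF d, of "\<bar>x (c (Suc k)) - x (c k)\<bar> powr p"]
      by (simp flip: powr_add)
  qed
qed

text \<open>From \<open>d powr (\<beta> * p)\<close> one factor \<open>d\<close> is kept and the
  remaining power is bounded through the mesh. The kept factors telescope to \<open>t\<close>, so
  the number of grid points need not be estimated.\<close>

lemma stopped_energy_hoelder_le:
  assumes "0 < h" "a \<in> {0..<h}" "t \<in> {0..T}" "0 < p" "0 \<le> K" "1 < \<beta> * p"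
    and hoelder: "\<And>s u. s \<in> {0..T} \<Longrightarrow> u \<in> {0..T} \<Longrightarrow> \<bar>z u - z s\<bar> \<le> K * \<bar>u - s\<bar> powr \<beta>"
  shows "stopped_energy p (shifted_grid T h a) z t \<le> K powr p * h powr (\<beta> * p - 1) * t"
proof -
  obtain n c where V: "\<And>p x. stopped_energy p (shifted_grid T h a) x t
        = (\<Sum>k<n. \<bar>x (c (Suc k)) - x (c k)\<bar> powr p)"
    and c: "c 0 = 0" "c n = t" "\<And>k. c k \<in> {0..t}" "\<And>k. c k \<le> c (Suc k)" "\<And>k. c (Suc k) - c k \<le> h"
    by (rule stopped_energy_grid_points[OF assms(1-3)]) (rule that)
  have "stopped_energy p (shifted_grid T h a) z t
      \<le> (\<Sum>k<n. K powr p * h powr (\<beta> * p - 1) * (c (Suc k) - c k))"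
    unfolding V
  proof (rule sum_mono)
    fix k
    let ?d = "c (Suc k) - c k"
    have d: "0 \<le> ?d" "?d \<le> h" using c by auto
    have "\<bar>z (c (Suc k)) - z (c k)\<bar> \<le> K * \<bar>?d\<bar> powr \<beta>"
      using c(3)[of k] c(3)[of "Suc k"] assms(3) by (intro hoelder) auto
    then have "\<bar>z (c (Suc k)) - z (c k)\<bar> powr p \<le> (K * ?d powr \<beta>) powr p"
      using assms(4) d by (intro powr_mono2) auto
    also have "\<dots> = K powr p * (?d powr (\<beta> * p - 1) * ?d powr 1)"
      unfolding powr_add[symmetric] using assms(5) by (simp add: powr_mult powr_powr)
    also have "\<dots> \<le> K powr p * (h powr (\<beta> * p - 1) * ?d powr 1)"
      using d assms(6) by (intro mult_left_mono mult_right_mono powr_mono2) auto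
    finally show "\<bar>z (c (Suc k)) - z (c k)\<bar> powr p \<le> K powr p * h powr (\<beta> * p - 1) * ?d"
      using d by simp
  qed
  also have "\<dots> = K powr p * h powr (\<beta> * p - 1) * t"
    by (simp add: sum_lessThan_telescope c(1,2) flip: sum_distrib_left)
  finally show ?thesis .
qed

subsection \<open>Uniform convergence of grid energies\<close>

text \<open>The form of a vanishing \<open>energy_modulus\<close> that avoids suprema in
  \<open>ereal\<close>: the supremum over meshes up to \<open>\<delta>\<close> is absorbed by
  "eventually". The limit may be the zero function, which expresses that the energies of a path
  vanish uniformly.\<close>

definition energy_converges ::
    "real \<Rightarrow> real \<Rightarrow> (real \<Rightarrow> real) \<Rightarrow> (real \<Rightarrow> real) \<Rightarrow> bool" where
  "energy_converges p T A x \<longleftrightarrow> (\<forall>e>0. \<forall>\<^sub>F h in at_right 0. \<forall>a\<in>{0..<h}. \<forall>t\<in>{0..T}.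
     \<bar>stopped_energy p (shifted_grid T h a) x t - A t\<bar> < e)"

lemma energy_convergesD:
  "energy_converges p T A x \<Longrightarrow> 0 < e \<Longrightarrow> \<forall>\<^sub>F h in at_right 0. \<forall>a\<in>{0..<h}. \<forall>t\<in>{0..T}.
     \<bar>stopped_energy p (shifted_grid T h a) x t - A t\<bar> < e"
  by (simp add: energy_converges_def)

lemma energy_modulus_ge:
  assumes "0 < h" "h \<le> \<delta>" "a \<in> {0..<h}" "t \<in> {0..T}"
  shows "ereal \<bar>stopped_energy p (shifted_grid T h a) x t - A t\<bar> \<le> energy_modulus p T A x \<delta>"
  unfolding energy_modulus_def
  by (rule SUP_upper2[of h], use assms in simp, rule SUP_upper2[of a], use assms in simp,
      rule SUP_upper2[of t], use assms in simp_all)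

lemma tendsto_0_ereal_nonneg:
  fixes f :: "'a \<Rightarrow> ereal"
  assumes "\<forall>\<^sub>F x in F. 0 \<le> f x" "\<And>e. 0 < e \<Longrightarrow> \<forall>\<^sub>F x in F. f x \<le> ereal e"
  shows "(f \<longlongrightarrow> 0) F"
proof (rule order_tendstoI)
  fix b :: ereal assume "b < 0"
  with assms(1) show "\<forall>\<^sub>F x in F. b < f x" by (auto elim!: eventually_mono)
next
  fix b :: ereal assume "0 < b"
  then obtain e where "0 < ereal e" "ereal e < b" using ereal_dense2 by blast
  with assms(2)[of e] show "\<forall>\<^sub>F x in F. f x < b" by (auto elim!: eventually_mono)
qed

text \<open>The modulus at \<open>h\<close> dominates every grid of mesh \<open>h\<close>.
  Conversely, a bound for all meshes below some \<open>b\<close> passes, as a non-strict one, to the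
  supremum over meshes up to any \<open>\<delta> < b\<close>.\<close>

lemma energy_modulus_tendsto_0_iff:
  assumes "0 \<le> T"
  shows "(energy_modulus p T A x \<longlongrightarrow> 0) (at_right 0) \<longleftrightarrow> energy_converges p T A x"
proof
  assume lim: "(energy_modulus p T A x \<longlongrightarrow> 0) (at_right 0)"
  show "energy_converges p T A x"
    unfolding energy_converges_def
  proof (intro allI impI)
    fix e :: real assume "0 < e"
    then have "\<forall>\<^sub>F h in at_right 0. energy_modulus p T A x h < ereal e"
      using lim by (intro order_tendstoD(2)) auto
    then show "\<forall>\<^sub>F h in at_right 0. \<forall>a\<in>{0..<h}. \<forall>t\<in>{0..T}.
        \<bar>stopped_energy p (shifted_grid T h a) x t - A t\<bar> < e"
      using eventually_at_right_less[of 0]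
    proof eventually_elim
      case (elim h)
      show ?case
      proof (intro ballI)
        fix a t assume at: "a \<in> {0..<h}" "t \<in> {0..T}"
        have "ereal \<bar>stopped_energy p (shifted_grid T h a) x t - A t\<bar> \<le> energy_modulus p T A x h"
          using elim at by (intro energy_modulus_ge) auto
        also have "\<dots> < ereal e" using elim by simp
        finally show "\<bar>stopped_energy p (shifted_grid T h a) x t - A t\<bar> < e" by simp
      qed
    qed
  qed
next
  assume conv: "energy_converges p T A x"
  show "(energy_modulus p T A x \<longlongrightarrow> 0) (at_right 0)"
  proof (rule tendsto_0_ereal_nonneg)
    show "\<forall>\<^sub>F \<delta> in at_right 0. 0 \<le> energy_modulus p T A x \<delta>"
      using eventually_at_right_less[of 0]
    proof eventually_elim
      case (elim \<delta>)
      have "0 \<le> ereal \<bar>stopped_energy p (shifted_grid T \<delta> 0) x 0 - A 0\<bar>" by simp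
      also have "\<dots> \<le> energy_modulus p T A x \<delta>"
        using elim assms by (intro energy_modulus_ge) auto
      finally show ?case .
    qed
  next
    fix e :: real assume "0 < e"
    from energy_convergesD[OF conv this] obtain b where b: "0 < b"
      "\<And>h a t. 0 < h \<Longrightarrow> h < b \<Longrightarrow> a \<in> {0..<h} \<Longrightarrow> t \<in> {0..T} \<Longrightarrow>
        \<bar>stopped_energy p (shifted_grid T h a) x t - A t\<bar> < e"
      unfolding eventually_at_right_field by blast
    then have "energy_modulus p T A x \<delta> \<le> ereal e" if "\<delta> < b" for \<delta>
      unfolding energy_modulus_def using that
      by (intro SUP_least) (auto intro!: less_imp_le)
    with b(1) show "\<forall>\<^sub>F \<delta> in at_right 0. energy_modulus p T A x \<delta> \<le> ereal e"
      unfolding eventually_at_right_field by blast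
  qed
qed

lemma is_intrinsic_energy_iff:
  "0 \<le> T \<Longrightarrow> is_intrinsic_energy p T x A \<longleftrightarrow> energy_profile T A \<and> 0 < A T \<and> energy_converges p T A x"
  by (simp add: is_intrinsic_energy_def energy_modulus_tendsto_0_iff)

text \<open>Needed besides \<open>is_intrinsic_energy_unique\<close> for limits that may vanish at
  \<open>T\<close>; this is how a rescaled path with zero limit is recognised as not rough.\<close>

lemma energy_converges_unique:
  assumes "energy_converges p T A x" "energy_converges p T B x" "t \<in> {0..T}"
  shows "A t = B t"
proof (rule ccontr)
  assume "A t \<noteq> B t"
  then have "0 < \<bar>A t - B t\<bar> / 2" by simp
  from energy_convergesD[OF assms(1) this] energy_convergesD[OF assms(2) this]
  have "\<forall>\<^sub>F h in at_right (0::real). False"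
    using eventually_at_right_less[of 0]
  proof eventually_elim
    case (elim h)
    then have "dist (stopped_energy p (shifted_grid T h 0) x t) (A t) < \<bar>A t - B t\<bar> / 2"
      "dist (stopped_energy p (shifted_grid T h 0) x t) (B t) < \<bar>A t - B t\<bar> / 2"
      using assms(3) by (auto simp: dist_real_def)
    then have "dist (A t) (B t) < \<bar>A t - B t\<bar>" by (rule dist_triangle_half_r)
    then show False by (simp add: dist_real_def)
  qed
  then show False by simp
qed

lemma energy_profile_le:
  assumes "energy_profile T A" "t \<in> {0..T}"
  shows "A t \<le> A T"
  using assms by (auto simp: energy_profile_def intro!: mono_onD[of "{0..T}" A])

text \<open>The convexity bound is applied to \<open>x + z\<close> and, for the reverse estimate, to
  \<open>x = (x + z) + (- z)\<close>. First \<open>\<theta>\<close> is taken so near 1 that the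
  energy of \<open>x\<close> is barely inflated; the weight of the energy of \<open>z\<close> may
  then be large, but it is fixed before the mesh tends to 0.\<close>

lemma energy_converges_add:
  assumes "1 < p" "energy_converges p T A x" "energy_converges p T (\<lambda>_. 0) z"
    and A: "\<And>t. t \<in> {0..T} \<Longrightarrow> \<bar>A t\<bar> \<le> M"
  shows "energy_converges p T A (\<lambda>t. x t + z t)"
  unfolding energy_converges_def
proof (intro allI impI)
  fix e :: real assume e: "0 < e"
  define N where "N = \<bar>M\<bar> + 1"
  \<comment> \<open>The total error will be at most \<open>\<eta> * (2 * N + 2)\<close>, which this
    choice keeps below \<open>e / 2\<close>; \<open>\<eta> \<le> 1\<close> serves the crude bound on
    the energy of the sum.\<close>
  define \<eta> where "\<eta> = min 1 (e / (4 * (N + 1)))"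
  \<comment> \<open>Solves \<open>\<theta> powr (1 - p) = 1 + \<eta>\<close>; since
    \<open>1 < p\<close>, the solution lies below 1.\<close>
  define \<theta> where "\<theta> = (1 + \<eta>) powr (1 / (1 - p))"
  define C where "C = (1 - \<theta>) powr (1 - p)"
  have N: "1 \<le> N" by (simp add: N_def)
  have \<eta>: "0 < \<eta>" "\<eta> \<le> 1" "\<eta> \<le> e / (4 * (N + 1))"
    using e N by (auto simp: \<eta>_def)
  have \<eta>e: "\<eta> * (2 * N + 2) \<le> e / 2"
    using \<eta>(3) N by (simp add: pos_le_divide_eq algebra_simps)
  have \<theta>: "0 < \<theta>" "\<theta> < 1" "\<theta> powr (1 - p) = 1 + \<eta>"
    using \<eta> assms(1) by (auto simp: \<theta>_def powr_powr powr_less_one)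
  have C: "0 < C" using \<theta> by (simp add: C_def)
  \<comment> \<open>Accuracy 1 gives the bound \<open>N\<close> on the energy of \<open>x\<close>,
    accuracy \<open>e / 2\<close> leaves room for the perturbation, and \<open>\<eta> / C\<close>
    compensates the weight of \<open>z\<close>.\<close>
  have "0 < min 1 (e / 2)" "0 < \<eta> / C" using e \<eta> C by auto
  from energy_convergesD[OF assms(2) this(1)] energy_convergesD[OF assms(3) this(2)]
  show "\<forall>\<^sub>F h in at_right 0. \<forall>a\<in>{0..<h}. \<forall>t\<in>{0..T}.
      \<bar>stopped_energy p (shifted_grid T h a) (\<lambda>t. x t + z t) t - A t\<bar> < e"
  proof eventually_elim
    case (elim h)
    show ?case
    proof (intro ballI)
      fix a t assume at: "a \<in> {0..<h}" "t \<in> {0..T}"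
      let ?V = "\<lambda>x. stopped_energy p (shifted_grid T h a) x t"
      let ?w = "\<lambda>t. x t + z t"
      have x: "\<bar>?V x - A t\<bar> < 1" "\<bar>?V x - A t\<bar> < e / 2"
        using elim(1)[rule_format, OF at] by auto
      with A[OF at(2)] have xN: "?V x \<le> N" by (simp add: N_def)
      have "?V z < \<eta> / C" using elim(2)[rule_format, OF at] by simp
      then have z: "C * ?V z < \<eta>" using C by (simp add: field_simps)
      have p1: "1 \<le> p" using assms(1) by simp
      have up: "?V ?w \<le> ?V x + \<eta> * ?V x + C * ?V z"
        using stopped_energy_add_le[OF p1 \<theta>(1,2), of "shifted_grid T h a" x z t]
        by (simp add: \<theta>(3) C_def distrib_right)
      have lo: "?V x \<le> ?V ?w + \<eta> * ?V ?w + C * ?V z"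
        using stopped_energy_add_le[OF p1 \<theta>(1,2), of "shifted_grid T h a" ?w "\<lambda>t. - z t" t]
        by (simp add: \<theta>(3) C_def distrib_right stopped_energy_uminus)
      have mult: "\<eta> * ?V x \<le> \<eta> * N" "0 \<le> \<eta> * N"
        using xN \<eta> N by (auto intro!: mult_left_mono)
      \<comment> \<open>The right-hand side of \<open>lo\<close> contains the energy of the sum
        itself, so an a priori bound on it is required.\<close>
      have "?V ?w \<le> 2 * N + 1"
        using up z mult xN mult_right_mono[OF \<eta>(2), of N] \<eta>(2) N by linarith
      then have "\<eta> * ?V ?w \<le> \<eta> * (2 * N + 1)"
        using \<eta> by (intro mult_left_mono) auto
      then have "\<eta> * ?V ?w \<le> 2 * (\<eta> * N) + \<eta>" by (simp add: algebra_simps)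
      moreover have "\<eta> * (2 * N + 2) = 2 * (\<eta> * N) + 2 * \<eta>" by (simp add: algebra_simps)
      ultimately have "\<bar>?V ?w - ?V x\<bar> \<le> \<eta> * (2 * N + 2)"
        using up lo z mult \<eta>(1) by linarith
      with x(2) \<eta>e show "\<bar>?V ?w - A t\<bar> < e" by linarith
    qed
  qed
qed

lemma eventually_small_oscillation:
  fixes x :: "real \<Rightarrow> real"
  assumes "continuous_on {0..T} x" "0 < \<epsilon>"
  shows "\<forall>\<^sub>F h in at_right 0. \<forall>s\<in>{0..T}. \<forall>u\<in>{0..T}. \<bar>u - s\<bar> \<le> h \<longrightarrow> \<bar>x u - x s\<bar> \<le> \<epsilon>"
proof -
  have "uniformly_continuous_on {0..T} x"
    using assms(1) by (intro compact_uniformly_continuous) auto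
  from uniformly_continuous_onE[OF this assms(2)] obtain d where "0 < d"
    and d: "\<And>s u. s \<in> {0..T} \<Longrightarrow> u \<in> {0..T} \<Longrightarrow> dist u s < d \<Longrightarrow> dist (x u) (x s) < \<epsilon>"
    by blast
  have "\<bar>x u - x s\<bar> \<le> \<epsilon>"
    if "h < d" "s \<in> {0..T}" "u \<in> {0..T}" "\<bar>u - s\<bar> \<le> h" for h s u
    using d[of s u] that by (simp add: dist_real_def)
  with \<open>0 < d\<close> show ?thesis
    unfolding eventually_at_right_field by blast
qed

text \<open>The \<open>p\<close>-energies are eventually bounded, and the oscillation factor in
  \<open>stopped_energy_le_exponent\<close> tends to 0 by uniform continuity.\<close>

lemma energy_converges_0_higher_exponent:
  assumes "energy_converges p T A x" "continuous_on {0..T} x" "p < q"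
    and A: "\<And>t. t \<in> {0..T} \<Longrightarrow> \<bar>A t\<bar> \<le> M"
  shows "energy_converges q T (\<lambda>_. 0) x"
  unfolding energy_converges_def
proof (intro allI impI)
  fix e :: real assume e: "0 < e"
  define N where "N = \<bar>M\<bar> + 1"
  \<comment> \<open>Chosen so that \<open>\<epsilon> powr (q - p) * N\<close> equals
    \<open>e / 2\<close>.\<close>
  define \<epsilon> where "\<epsilon> = (e / (2 * N)) powr (1 / (q - p))"
  have N: "1 \<le> N" by (simp add: N_def)
  have \<epsilon>: "0 < \<epsilon>" "\<epsilon> powr (q - p) = e / (2 * N)"
    using e N assms(3) by (auto simp: \<epsilon>_def powr_powr)
  from energy_convergesD[OF assms(1) zero_less_one] eventually_small_oscillation[OF assms(2) \<epsilon>(1)]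
    eventually_at_right_less[of 0]
  show "\<forall>\<^sub>F h in at_right 0. \<forall>a\<in>{0..<h}. \<forall>t\<in>{0..T}.
      \<bar>stopped_energy q (shifted_grid T h a) x t - 0\<bar> < e"
  proof eventually_elim
    case (elim h)
    show ?case
    proof (intro ballI)
      fix a t assume at: "a \<in> {0..<h}" "t \<in> {0..T}"
      have "stopped_energy q (shifted_grid T h a) x t
          \<le> \<epsilon> powr (q - p) * stopped_energy p (shifted_grid T h a) x t"
        using elim assms(3) at by (intro stopped_energy_le_exponent) auto
      also have "\<dots> \<le> \<epsilon> powr (q - p) * N"
        using elim(1)[rule_format, OF at] A[OF at(2)] by (intro mult_left_mono) (auto simp: N_def)
      also have "\<dots> < e" using \<epsilon> e N by simp
      finally show "\<bar>stopped_energy q (shifted_grid T h a) x t - 0\<bar> < e"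
        by (simp add: stopped_energy_nonneg)
    qed
  qed
qed

lemma energy_converges_0_hoelder:
  assumes "0 < p" "0 \<le> K" "1 < \<beta> * p"
    and "\<And>s u. s \<in> {0..T} \<Longrightarrow> u \<in> {0..T} \<Longrightarrow> \<bar>z u - z s\<bar> \<le> K * \<bar>u - s\<bar> powr \<beta>"
  shows "energy_converges p T (\<lambda>_. 0) z"
  unfolding energy_converges_def
proof (intro allI impI)
  fix e :: real assume e: "0 < e"
  have "((\<lambda>h. K powr p * h powr (\<beta> * p - 1) * T) \<longlongrightarrow> K powr p * 0 * T) (at_right 0)"
    using assms(3) by (intro tendsto_intros tendsto_zero_powrI[where b = "\<beta> * p - 1"])
      (auto simp: eventually_at_right_field intro: exI[of _ 1])
  then have "\<forall>\<^sub>F h in at_right 0. K powr p * h powr (\<beta> * p - 1) * T < e"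
    using e by (intro order_tendstoD(2)) auto
  then show "\<forall>\<^sub>F h in at_right 0. \<forall>a\<in>{0..<h}. \<forall>t\<in>{0..T}.
      \<bar>stopped_energy p (shifted_grid T h a) z t - 0\<bar> < e"
    using eventually_at_right_less[of 0]
  proof eventually_elim
    case (elim h)
    show ?case
    proof (intro ballI)
      fix a t assume at: "a \<in> {0..<h}" "t \<in> {0..T}"
      have "stopped_energy p (shifted_grid T h a) z t \<le> K powr p * h powr (\<beta> * p - 1) * t"
        using elim assms at by (intro stopped_energy_hoelder_le) auto
      also have "\<dots> \<le> K powr p * h powr (\<beta> * p - 1) * T"
        using at by (intro mult_left_mono) auto
      finally show "\<bar>stopped_energy p (shifted_grid T h a) z t - 0\<bar> < e"
        using elim by (simp add: stopped_energy_nonneg)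
    qed
  qed
qed

text \<open>The dilated grid is again a shifted grid, of mesh \<open>h / l \<le> h\<close>, so
  uniformity in offset and time carries over. Accuracy \<open>e / l\<close> absorbs the factor
  \<open>l\<close>.\<close>

lemma energy_converges_rescale:
  assumes "energy_converges p T A x" "1 \<le> l" "p \<noteq> 0"
  shows "energy_converges p T (rescale_energy l A) (rescale (1/p) l x)"
  unfolding energy_converges_def
proof (intro allI impI)
  fix e :: real assume "0 < e"
  then have "0 < e / l" using assms(2) by simp
  from energy_convergesD[OF assms(1) this] obtain b where b: "0 < b"
    "\<And>h a t. 0 < h \<Longrightarrow> h < b \<Longrightarrow> a \<in> {0..<h} \<Longrightarrow> t \<in> {0..T} \<Longrightarrow>
      \<bar>stopped_energy p (shifted_grid T h a) x t - A t\<bar> < e / l"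
    unfolding eventually_at_right_field by blast
  have "\<bar>stopped_energy p (shifted_grid T h a) (rescale (1/p) l x) t - rescale_energy l A t\<bar> < e"
    if "0 < h" "h < b" "a \<in> {0..<h}" "t \<in> {0..T}" for h a t
  proof -
    have t: "t / l \<le> t" "h / l \<le> h"
      using that assms(2) by (auto simp: divide_le_eq mult_le_cancel_left1)
    have "\<bar>stopped_energy p (shifted_grid T (h / l) (a / l)) x (t / l) - A (t / l)\<bar> < e / l"
      using that t assms(2) by (intro b(2)) (auto simp: divide_strict_right_mono)
    then have "l * \<bar>stopped_energy p (shifted_grid T (h / l) (a / l)) x (t / l) - A (t / l)\<bar> < e"
      using assms(2) by (simp add: field_simps)
    then show ?thesis
      using that t assms(2,3)
      by (subst stopped_energy_rescale) (auto simp: rescale_energy_def abs_mult simp flip: right_diff_distrib)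
  qed
  with b(1) show "\<forall>\<^sub>F h in at_right 0. \<forall>a\<in>{0..<h}. \<forall>t\<in>{0..T}.
      \<bar>stopped_energy p (shifted_grid T h a) (rescale (1/p) l x) t - rescale_energy l A t\<bar> < e"
    unfolding eventually_at_right_field by blast
qed

lemma energy_converges_cmult:
  assumes "energy_converges p T A x" "c \<noteq> 0"
  shows "energy_converges p T (\<lambda>t. \<bar>c\<bar> powr p * A t) (\<lambda>t. c * x t)"
  unfolding energy_converges_def
proof (intro allI impI)
  fix e :: real assume "0 < e"
  then have "0 < e / \<bar>c\<bar> powr p" using assms(2) by simp
  from energy_convergesD[OF assms(1) this]
  show "\<forall>\<^sub>F h in at_right 0. \<forall>a\<in>{0..<h}. \<forall>t\<in>{0..T}.
      \<bar>stopped_energy p (shifted_grid T h a) (\<lambda>t. c * x t) t - \<bar>c\<bar> powr p * A t\<bar> < e"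
  proof eventually_elim
    case (elim h)
    have "\<bar>\<bar>c\<bar> powr p * u - \<bar>c\<bar> powr p * v\<bar> = \<bar>u - v\<bar> * \<bar>c\<bar> powr p" for u v :: real
      by (simp add: abs_mult flip: right_diff_distrib)
    with elim show ?case
      using assms(2) by (simp add: stopped_energy_cmult pos_less_divide_eq)
  qed
qed

subsection \<open>Rough paths under rescaling\<close>

text \<open>Any witness agrees with \<open>intrinsic_energy\<close> on \<open>[0, T]\<close>, and
  the defining properties concern values there only, so the definite description inherits
  them.\<close>

lemma rough_pathsD:
  assumes "x \<in> rough_paths p T" "0 \<le> T"
  shows "continuous_on {0..T} x"
    and "energy_profile T (intrinsic_energy p T x)"
    and "0 < intrinsic_energy p T x T"
    and "energy_converges p T (intrinsic_energy p T x) x"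
proof -
  obtain A where A: "is_intrinsic_energy p T x A"
    using assms(1) by (auto simp: rough_paths_def)
  have "is_intrinsic_energy p T x (intrinsic_energy p T x)"
    using is_intrinsic_energy_cong[OF _ assms(2) A] intrinsic_energy_eqI[OF A assms(2)] by simp
  then show "energy_profile T (intrinsic_energy p T x)" "0 < intrinsic_energy p T x T"
    "energy_converges p T (intrinsic_energy p T x) x"
    by (simp_all add: is_intrinsic_energy_iff assms(2))
  show "continuous_on {0..T} x" using assms(1) by (simp add: rough_paths_def)
qed

lemma rough_pathsI:
  assumes "0 \<le> T" "continuous_on {0..T} x" "energy_profile T A" "0 < A T" "energy_converges p T A x"
  shows "x \<in> rough_paths p T" and "t \<in> {0..T} \<Longrightarrow> intrinsic_energy p T x t = A t"
proof -
  have A: "is_intrinsic_energy p T x A"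
    using assms by (simp add: is_intrinsic_energy_iff)
  show "x \<in> rough_paths p T" using assms(2) A by (auto simp: rough_paths_def)
  show "intrinsic_energy p T x t = A t" if "t \<in> {0..T}"
    using intrinsic_energy_eqI[OF A assms(1) that] .
qed

lemma divide_in_interval:
  assumes "t \<in> {0..T}" "(1::real) \<le> l"
  shows "t / l \<in> {0..T}"
proof -
  have "t / l \<le> t" using assms by (simp add: divide_le_eq mult_le_cancel_left1)
  with assms show ?thesis by auto
qed

lemma energy_profile_bound:
  assumes "energy_profile T A" "t \<in> {0..T}"
  shows "\<bar>A t\<bar> \<le> A T"
  using assms energy_profile_le[OF assms] by (simp add: energy_profile_def)

lemma energy_profile_rescale:
  assumes "energy_profile T A" "1 \<le> l"
  shows "energy_profile T (rescale_energy l A)"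
  unfolding energy_profile_def
proof (intro conjI ballI)
  have A: "continuous_on {0..T} A" "mono_on {0..T} A" "\<And>t. t \<in> {0..T} \<Longrightarrow> 0 \<le> A t" "A 0 = 0"
    using assms(1) by (auto simp: energy_profile_def)
  have "continuous_on {0..T} (\<lambda>t. A (t / l))"
    using assms(2) by (intro continuous_on_compose2[OF A(1)] continuous_intros image_subsetI)
      (auto intro: divide_in_interval simp del: atLeastAtMost_iff)
  then show "continuous_on {0..T} (rescale_energy l A)"
    unfolding rescale_energy_def by (intro continuous_intros)
  show "mono_on {0..T} (rescale_energy l A)"
  proof (rule mono_onI)
    fix r s assume rs: "r \<in> {0..T}" "s \<in> {0..T}" "r \<le> s"
    then have "A (r / l) \<le> A (s / l)"
      using assms(2) divide_in_interval by (intro mono_onD[OF A(2)]) (auto simp: divide_right_mono)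
    then show "rescale_energy l A r \<le> rescale_energy l A s"
      using assms(2) by (simp add: rescale_energy_def)
  qed
  show "0 \<le> rescale_energy l A t" if "t \<in> {0..T}" for t
    using A(3)[OF divide_in_interval[OF that assms(2)]] assms(2) by (simp add: rescale_energy_def)
  show "rescale_energy l A 0 = 0" by (simp add: rescale_energy_def A(4))
qed

lemma energy_profile_cmult:
  "energy_profile T A \<Longrightarrow> 0 \<le> c \<Longrightarrow> energy_profile T (\<lambda>t. c * A t)"
  unfolding energy_profile_def by (auto intro!: continuous_intros mono_onI mult_left_mono dest: mono_onD)

lemma continuous_on_rescale:
  assumes "continuous_on {0..T} x" "1 \<le> l"
  shows "continuous_on {0..T} (rescale \<gamma> l x)"
proof -
  have "continuous_on {0..T} (\<lambda>t. x (t / l))"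
    using assms(2) by (intro continuous_on_compose2[OF assms(1)] continuous_intros image_subsetI)
      (auto intro: divide_in_interval simp del: atLeastAtMost_iff)
  then show ?thesis
    unfolding rescale_def by (intro continuous_intros)
qed

lemma rescale_rescale:
  assumes "0 \<le> l" "0 \<le> m"
  shows "rescale \<gamma> l (rescale \<gamma> m x) = rescale \<gamma> (l * m) x"
  using assms by (simp add: rescale_def powr_mult fun_eq_iff)

lemma energy_modulus_rescale_le:
  assumes "p \<noteq> 0" "1 \<le> l"
  shows "energy_modulus p T (rescale_energy l A) (rescale (1/p) l x) \<delta>
    \<le> ereal l * energy_modulus p T A x (\<delta> / l)"
  unfolding energy_modulus_def[of p T "rescale_energy l A"]
proof (intro SUP_least)
  fix h a t assume at: "h \<in> {0<..\<delta>}" "a \<in> {0..<h}" "t \<in> {0..T}"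
  let ?D = "\<bar>stopped_energy p (shifted_grid T (h / l) (a / l)) x (t / l) - A (t / l)\<bar>"
  have tl: "t / l \<in> {0..T}" using at(3) assms(2) by (rule divide_in_interval)
  have "ereal \<bar>stopped_energy p (shifted_grid T h a) (rescale (1/p) l x) t - rescale_energy l A t\<bar>
      = ereal l * ereal ?D"
    using at tl assms
    by (subst stopped_energy_rescale) (auto simp: rescale_energy_def abs_mult simp flip: right_diff_distrib)
  also have "\<dots> \<le> ereal l * energy_modulus p T A x (\<delta> / l)"
    using at tl assms(2)
    by (intro ereal_mult_left_mono energy_modulus_ge) (auto simp: divide_right_mono divide_strict_right_mono)
  finally show "ereal \<bar>stopped_energy p (shifted_grid T h a) (rescale (1/p) l x) t - rescale_energy l A t\<bar>
    \<le> ereal l * energy_modulus p T A x (\<delta> / l)" .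
qed

text \<open>Continuity, profile and convergence to the rescaled energy hold in every case.
  Membership can fail only through the positivity of the limit at \<open>T\<close>, which is that of
  the original energy at \<open>T / l\<close>.\<close>

lemma rescale_rough_path_iff:
  assumes "p \<noteq> 0" "0 \<le> T" "x \<in> rough_paths p T" "1 \<le> l"
  shows "rescale (1/p) l x \<in> rough_paths p T \<longleftrightarrow> 0 < intrinsic_energy p T x (T / l)"
    and "0 < intrinsic_energy p T x (T / l) \<Longrightarrow> t \<in> {0..T} \<Longrightarrow>
      intrinsic_energy p T (rescale (1/p) l x) t = rescale_energy l (intrinsic_energy p T x) t"
proof -
  let ?A = "intrinsic_energy p T x"
  note x = rough_pathsD[OF assms(3,2)]
  have conv: "energy_converges p T (rescale_energy l ?A) (rescale (1/p) l x)"
    using x(4) assms by (intro energy_converges_rescale)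
  note I = rough_pathsI[OF assms(2) continuous_on_rescale[OF x(1) assms(4)]
      energy_profile_rescale[OF x(2) assms(4)] _ conv]
  have pos: "0 < rescale_energy l ?A T \<longleftrightarrow> 0 < ?A (T / l)"
    using assms(4) by (simp add: rescale_energy_def zero_less_mult_iff)
  show "rescale (1/p) l x \<in> rough_paths p T \<longleftrightarrow> 0 < ?A (T / l)"
  proof
    assume "rescale (1/p) l x \<in> rough_paths p T"
    note y = rough_pathsD[OF this assms(2)]
    have "intrinsic_energy p T (rescale (1/p) l x) T = rescale_energy l ?A T"
      using assms(2) by (intro energy_converges_unique[OF y(4) conv]) simp
    with y(3) show "0 < ?A (T / l)" by (simp add: pos)
  next
    assume "0 < ?A (T / l)"
    with I(1) show "rescale (1/p) l x \<in> rough_paths p T" by (simp add: pos)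
  qed
  show "intrinsic_energy p T (rescale (1/p) l x) t = rescale_energy l ?A t"
    if "0 < ?A (T / l)" "t \<in> {0..T}"
    using I(2)[OF _ that(2)] that(1) by (simp add: pos)
qed

lemma rescale_pos_rough_path:
  assumes "p \<noteq> 0" "0 < T" "x \<in> pos_rough_paths p T" "1 \<le> l"
  shows "rescale (1/p) l x \<in> pos_rough_paths p T"
    and "t \<in> {0..T} \<Longrightarrow>
      intrinsic_energy p T (rescale (1/p) l x) t = rescale_energy l (intrinsic_energy p T x) t"
proof -
  have x: "x \<in> rough_paths p T" and pos: "\<And>t. t \<in> {0<..T} \<Longrightarrow> 0 < intrinsic_energy p T x t"
    using assms(3) by (auto simp: pos_rough_paths_def)
  have div: "t / l \<in> {0<..T}" if "t \<in> {0<..T}" for t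
    using divide_in_interval[of t T l] that assms(4) by auto
  have T: "0 \<le> T" "0 < intrinsic_energy p T x (T / l)"
    using assms(2) by (auto intro!: pos div)
  note R = rescale_rough_path_iff[OF assms(1) T(1) x assms(4)]
  show *: "intrinsic_energy p T (rescale (1/p) l x) t = rescale_energy l (intrinsic_energy p T x) t"
    if "t \<in> {0..T}" for t
    by (rule R(2)[OF T(2) that])
  show "rescale (1/p) l x \<in> pos_rough_paths p T"
    unfolding pos_rough_paths_def
  proof (intro CollectI conjI ballI)
    show "rescale (1/p) l x \<in> rough_paths p T" using R(1) T(2) by simp
    fix t assume t: "t \<in> {0<..T}"
    then show "0 < intrinsic_energy p T (rescale (1/p) l x) t"
      using pos[OF div[OF t]] assms(4) by (simp add: * rescale_energy_def)
  qed
qed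

text \<open>Invariance with \<open>l = T / t\<close>, evaluated at time \<open>T\<close>, reads
  \<open>(T / t) * A t = A T\<close>; time 0 is covered by \<open>A 0 = 0\<close>.\<close>

lemma rescale_energy_invariant_iff:
  assumes "0 < T" "A 0 = 0"
  shows "(\<forall>l\<ge>1. \<forall>t\<in>{0..T}. rescale_energy l A t = A t) \<longleftrightarrow> (\<forall>t\<in>{0..T}. A t = A T * t / T)"
proof (intro iffI allI ballI impI)
  fix t assume inv: "\<forall>l\<ge>1. \<forall>t\<in>{0..T}. rescale_energy l A t = A t" and t: "t \<in> {0..T}"
  show "A t = A T * t / T"
  proof (cases "t = 0")
    case False
    with t have "1 \<le> T / t" by simp
    with inv assms(1) have "rescale_energy (T / t) A T = A T" by simp
    with False assms(1) show ?thesis by (simp add: rescale_energy_def field_simps)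
  qed (simp add: assms(2))
next
  fix l t :: real
  assume lin: "\<forall>t\<in>{0..T}. A t = A T * t / T" and l: "1 \<le> l" and t: "t \<in> {0..T}"
  show "rescale_energy l A t = A t"
    using lin[rule_format, OF divide_in_interval[OF t l]] lin[rule_format, OF t] l
    by (simp add: rescale_energy_def)
qed

text \<open>The difference from the limit is \<open>t * (A (t / l) / (t / l) - \<alpha>)\<close>.
  Once \<open>l > T / b\<close>, all arguments \<open>t / l\<close> lie below \<open>b\<close>
  simultaneously, and the prefactor is at most \<open>T\<close>.\<close>

lemma rescale_energy_uniform_limit:
  assumes "0 < T" "A 0 = 0" "((\<lambda>s. A s / s) \<longlongrightarrow> \<alpha>) (at_right 0)"
  shows "uniform_limit {0..T} (\<lambda>l. rescale_energy l A) (\<lambda>t. \<alpha> * t) at_top"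
proof (rule uniform_limitI)
  fix e :: real assume "0 < e"
  then have "0 < e / T" using assms(1) by simp
  from tendstoD[OF assms(3) this] obtain b where b: "0 < b"
    "\<And>s. 0 < s \<Longrightarrow> s < b \<Longrightarrow> \<bar>A s / s - \<alpha>\<bar> < e / T"
    unfolding eventually_at_right_field dist_real_def by blast
  show "\<forall>\<^sub>F l in at_top. \<forall>t\<in>{0..T}. dist (rescale_energy l A t) (\<alpha> * t) < e"
    using eventually_gt_at_top[of "T / b"]
  proof eventually_elim
    case (elim l)
    have "0 \<le> T / b" using assms(1) b(1) by simp
    with elim have l: "0 < l" by linarith
    show ?case
    proof
      fix t assume t: "t \<in> {0..T}"
      show "dist (rescale_energy l A t) (\<alpha> * t) < e"
      proof (cases "t = 0")
        case True
        then show ?thesis using \<open>0 < e\<close> by (simp add: rescale_energy_def assms(2))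
      next
        case False
        have "t < b * l" using elim t b(1) by (simp add: field_simps)
        then have "\<bar>A (t / l) / (t / l) - \<alpha>\<bar> < e / T"
          using False t l by (intro b(2)) (auto simp: divide_less_eq)
        then have "t * \<bar>A (t / l) / (t / l) - \<alpha>\<bar> < t * (e / T)"
          using False t by (intro mult_strict_left_mono) auto
        also have "\<dots> \<le> T * (e / T)"
          using t \<open>0 < e\<close> by (intro mult_right_mono) auto
        also have "T * (e / T) = e" using assms(1) by simp
        also have "t * \<bar>A (t / l) / (t / l) - \<alpha>\<bar> = \<bar>t * (A (t / l) / (t / l) - \<alpha>)\<bar>"
          using t by (simp add: abs_mult)
        also have "t * (A (t / l) / (t / l) - \<alpha>) = rescale_energy l A t - \<alpha> * t"
          using False l by (simp add: rescale_energy_def field_simps)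
        finally show ?thesis by (simp add: dist_real_def)
      qed
    qed
  qed
qed

text \<open>The quotient forces positivity near 0, and monotonicity propagates it up to
  \<open>t\<close>.\<close>

lemma energy_profile_pos:
  assumes "energy_profile T A" "0 < \<alpha>" "((\<lambda>s. A s / s) \<longlongrightarrow> \<alpha>) (at_right 0)" "t \<in> {0<..T}"
  shows "0 < A t"
proof -
  have "\<forall>\<^sub>F s in at_right 0. 0 < A s / s"
    using assms(2,3) by (intro order_tendstoD(1))
  then obtain b where b: "0 < b" "\<And>s. 0 < s \<Longrightarrow> s < b \<Longrightarrow> 0 < A s / s"
    unfolding eventually_at_right_field by blast
  define s where "s = min t (b / 2)"
  have s: "0 < s" "s < b" "s \<le> t" using b(1) assms(4) by (auto simp: s_def)
  then have "0 < A s" using b(2)[of s] by (simp add: zero_less_divide_iff)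
  also have "A s \<le> A t"
    using assms(1,4) s by (auto simp: energy_profile_def intro!: mono_onD[of "{0..T}" A])
  finally show ?thesis .
qed

text \<open>The path is \<open>l powr (\<gamma> - 1/p)\<close> times the rescaling with exponent
  \<open>1/p\<close>, and a constant factor enters the energy with its \<open>p\<close>-th
  power.\<close>

lemma rescale_rough_path_general:
  assumes "0 < p" "0 < T" "x \<in> rough_paths p T" "1 \<le> l" "0 < intrinsic_energy p T x (T / l)"
  shows "rescale \<gamma> l x \<in> rough_paths p T"
    and "t \<in> {0..T} \<Longrightarrow> intrinsic_energy p T (rescale \<gamma> l x) t
      = l powr (\<gamma> * p - 1) * rescale_energy l (intrinsic_energy p T x) t"
proof -
  let ?A = "intrinsic_energy p T x" and ?c = "l powr (\<gamma> - 1 / p)"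
  have T: "0 \<le> T" using assms(2) by simp
  note x = rough_pathsD[OF assms(3) T]
  have eq: "rescale \<gamma> l x = (\<lambda>t. ?c * rescale (1/p) l x t)"
    using assms(4) by (auto simp: rescale_def fun_eq_iff simp flip: powr_add)
  have c: "\<bar>?c\<bar> powr p = l powr (\<gamma> * p - 1)"
    using assms(1) by (simp add: powr_powr left_diff_distrib)
  have "energy_converges p T (\<lambda>t. \<bar>?c\<bar> powr p * rescale_energy l ?A t) (rescale \<gamma> l x)"
    unfolding eq using x(4) assms by (intro energy_converges_cmult energy_converges_rescale) auto
  then have conv: "energy_converges p T (\<lambda>t. l powr (\<gamma> * p - 1) * rescale_energy l ?A t) (rescale \<gamma> l x)"
    unfolding c .
  have prof: "energy_profile T (\<lambda>t. l powr (\<gamma> * p - 1) * rescale_energy l ?A t)"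
    using x(2) assms(4) by (intro energy_profile_cmult energy_profile_rescale) auto
  have pos: "0 < l powr (\<gamma> * p - 1) * rescale_energy l ?A T"
    using assms(4,5) by (simp add: rescale_energy_def)
  note I = rough_pathsI[OF T continuous_on_rescale[OF x(1) assms(4)] prof pos conv]
  show "rescale \<gamma> l x \<in> rough_paths p T" by (rule I(1))
  show "intrinsic_energy p T (rescale \<gamma> l x) t = l powr (\<gamma> * p - 1) * rescale_energy l ?A t"
    if "t \<in> {0..T}" by (rule I(2)[OF that])
qed

text \<open>By uniform convergence the rescaled energies are eventually bounded by
  \<open>\<alpha> * T + 1\<close>, and the negative power of \<open>l\<close> multiplies this
  bound.\<close>

lemma powr_rescale_energy_uniform_limit_0:
  assumes "0 < T" "0 \<le> \<alpha>" "A 0 = 0" "((\<lambda>s. A s / s) \<longlongrightarrow> \<alpha>) (at_right 0)" "r < 0"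
  shows "uniform_limit {0..T} (\<lambda>l t. l powr r * rescale_energy l A t) (\<lambda>t. 0) at_top"
proof (rule uniform_limitI)
  fix e :: real assume "0 < e"
  have "((\<lambda>l. l powr r * (\<alpha> * T + 1)) \<longlongrightarrow> 0 * (\<alpha> * T + 1)) at_top"
    using assms(5) by (intro tendsto_intros tendsto_neg_powr filterlim_ident)
  then have "\<forall>\<^sub>F l in at_top. l powr r * (\<alpha> * T + 1) < e"
    using \<open>0 < e\<close> by (intro order_tendstoD(2)) auto
  with uniform_limitD[OF rescale_energy_uniform_limit[OF assms(1,3,4)] zero_less_one]
  show "\<forall>\<^sub>F l in at_top. \<forall>t\<in>{0..T}. dist (l powr r * rescale_energy l A t) 0 < e"
  proof eventually_elim
    case (elim l)
    show ?case
    proof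
      fix t assume t: "t \<in> {0..T}"
      have "\<bar>rescale_energy l A t - \<alpha> * t\<bar> < 1" "0 \<le> \<alpha> * t" "\<alpha> * t \<le> \<alpha> * T"
        using elim(1) t assms(2) by (auto simp: dist_real_def intro: mult_left_mono)
      then have "\<bar>rescale_energy l A t\<bar> \<le> \<alpha> * T + 1" by linarith
      then have "l powr r * \<bar>rescale_energy l A t\<bar> \<le> l powr r * (\<alpha> * T + 1)"
        by (intro mult_left_mono) auto
      with elim(2) show "dist (l powr r * rescale_energy l A t) 0 < e"
        by (simp add: abs_mult)
    qed
  qed
qed

lemma powr_rescale_energy_at_top:
  assumes "0 < \<alpha>" "A 0 = 0" "((\<lambda>s. A s / s) \<longlongrightarrow> \<alpha>) (at_right 0)" "0 < r" "0 < t"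
  shows "filterlim (\<lambda>l. l powr r * rescale_energy l A t) at_top at_top"
proof -
  \<comment> \<open>The uniform limit is used with \<open>t\<close> itself as time horizon.\<close>
  have "((\<lambda>l. rescale_energy l A t) \<longlongrightarrow> \<alpha> * t) at_top"
    using assms by (intro tendsto_uniform_limitI[OF rescale_energy_uniform_limit[of t]]) auto
  moreover have "filterlim (\<lambda>l. l powr r) at_top at_top"
    using assms(4) by real_asymp
  ultimately have "filterlim (\<lambda>l. rescale_energy l A t * l powr r) at_top at_top"
    using assms by (intro filterlim_tendsto_pos_mult_at_top[where c = "\<alpha> * t"]) auto
  then show ?thesis by (simp add: mult.commute)
qed

subsection \<open>Perturbations\<close>

text \<open>With \<open>0 < T\<close> the supremum is over a nonempty set, hence nonnegative rather
  than minus infinity; together with finiteness, \<open>real_of_ereal\<close> returns its true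
  value.\<close>

lemma hoelder_const_bound:
  assumes "0 < T" "hoelder_const T \<beta> z < \<infinity>"
  shows "0 \<le> real_of_ereal (hoelder_const T \<beta> z)"
    and "s \<in> {0..T} \<Longrightarrow> u \<in> {0..T} \<Longrightarrow>
      \<bar>z u - z s\<bar> \<le> real_of_ereal (hoelder_const T \<beta> z) * \<bar>u - s\<bar> powr \<beta>"
proof -
  have up: "ereal (\<bar>z u - z s\<bar> / \<bar>u - s\<bar> powr \<beta>) \<le> hoelder_const T \<beta> z"
    if "s \<in> {0..T}" "u \<in> {0..T}" "s \<noteq> u" for s u
    unfolding hoelder_const_def by (rule SUP_upper2[of "(s, u)"]) (use that in auto)
  have "0 \<le> ereal (\<bar>z T - z 0\<bar> / \<bar>T - 0\<bar> powr \<beta>)" by simp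
  also have "\<dots> \<le> hoelder_const T \<beta> z" using assms(1) by (intro up) auto
  finally have nonneg: "0 \<le> hoelder_const T \<beta> z" .
  then obtain K where K: "hoelder_const T \<beta> z = ereal K"
    using assms(2) by (cases "hoelder_const T \<beta> z") auto
  show "0 \<le> real_of_ereal (hoelder_const T \<beta> z)" using nonneg K by simp
  show "\<bar>z u - z s\<bar> \<le> real_of_ereal (hoelder_const T \<beta> z) * \<bar>u - s\<bar> powr \<beta>"
    if "s \<in> {0..T}" "u \<in> {0..T}"
    using up[OF that] by (cases "s = u") (auto simp: K pos_divide_le_eq)
qed

lemma stopped_energy_rescale_hoelder_le:
  assumes "0 < T" "0 < p" "1 < \<beta> * p" "0 \<le> K" "1 \<le> l" "0 < h" "h \<le> \<delta>" "a \<in> {0..<h}" "t \<in> {0..T}"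
    and hoelder: "\<And>s u. s \<in> {0..T} \<Longrightarrow> u \<in> {0..T} \<Longrightarrow> \<bar>z u - z s\<bar> \<le> K * \<bar>u - s\<bar> powr \<beta>"
  shows "stopped_energy p (shifted_grid T h a) (rescale (1/p) l z) t
    \<le> K powr p * (T + 2 * \<delta>) * \<delta> powr (\<beta> * p - 1) * l powr (1 - \<beta> * p)"
proof -
  have tl: "t / l \<in> {0..T}" using assms(9,5) by (rule divide_in_interval)
  have "stopped_energy p (shifted_grid T h a) (rescale (1/p) l z) t
      = l * stopped_energy p (shifted_grid T (h / l) (a / l)) z (t / l)"
    using assms tl by (intro stopped_energy_rescale) auto
  also have "\<dots> \<le> l * (K powr p * (h / l) powr (\<beta> * p - 1) * (t / l))"
    using assms tl
    by (intro mult_left_mono stopped_energy_hoelder_le) (auto simp: divide_strict_right_mono)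
  \<comment> \<open>The powers of \<open>l\<close> come from the energy, the mesh and the stopping
    time: \<open>1 - (\<beta> * p - 1) - 1 = 1 - \<beta> * p\<close>.\<close>
  also have "\<dots> = K powr p * t * h powr (\<beta> * p - 1) * l powr (1 - \<beta> * p)"
    using assms(5,6) by (simp add: powr_divide powr_diff field_simps)
  also have "\<dots> \<le> K powr p * (T + 2 * \<delta>) * \<delta> powr (\<beta> * p - 1) * l powr (1 - \<beta> * p)"
    using assms by (intro order_refl mult_mono powr_mono2) auto
  finally show ?thesis .
qed

lemma rough_path_add_negligible:
  assumes "1 < p" "0 \<le> T" "x \<in> rough_paths p T" "continuous_on {0..T} z" "energy_converges p T (\<lambda>_. 0) z"
  shows "(\<lambda>t. x t + z t) \<in> rough_paths p T"
    and "t \<in> {0..T} \<Longrightarrow> intrinsic_energy p T (\<lambda>t. x t + z t) t = intrinsic_energy p T x t"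
proof -
  note x = rough_pathsD[OF assms(3,2)]
  have conv: "energy_converges p T (intrinsic_energy p T x) (\<lambda>t. x t + z t)"
    by (rule energy_converges_add[OF assms(1) x(4) assms(5) energy_profile_bound[OF x(2)]])
  have cont: "continuous_on {0..T} (\<lambda>t. x t + z t)"
    using x(1) assms(4) by (intro continuous_intros)
  note I = rough_pathsI[OF assms(2) cont x(2,3) conv]
  show "(\<lambda>t. x t + z t) \<in> rough_paths p T" by (rule I(1))
  show "intrinsic_energy p T (\<lambda>t. x t + z t) t = intrinsic_energy p T x t" if "t \<in> {0..T}"
    by (rule I(2)[OF that])
qed

text \<open>The \<open>q\<close>-energy at \<open>T\<close> stays above half its positive limit,
  while it is at most a power of the small oscillation times the \<open>r\<close>-energy; the latter
  must therefore explode, uniformly in the offset.\<close>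

lemma stopped_energy_lower_exponent_tendsto_PInf:
  assumes "0 \<le> T" "w \<in> rough_paths q T" "r < q"
  shows "((\<lambda>h. INF a\<in>{0..<h}. ereal (stopped_energy r (shifted_grid T h a) w T)) \<longlongrightarrow> \<infinity>) (at_right 0)"
  unfolding tendsto_PInfty
proof
  fix M :: real
  note w = rough_pathsD[OF assms(2,1)]
  define A where "A = intrinsic_energy q T w T / 2"
  define N where "N = \<bar>M\<bar> + 1"
  define \<epsilon> where "\<epsilon> = (A / N) powr (1 / (q - r))"
  have A: "0 < A" using w(3) by (simp add: A_def)
  have N: "0 < N" "M < N" by (auto simp: N_def)
  have \<epsilon>: "0 < \<epsilon>" "\<epsilon> powr (q - r) = A / N"
    using A N assms(3) by (auto simp: \<epsilon>_def powr_powr)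
  from energy_convergesD[OF w(4) A] eventually_small_oscillation[OF w(1) \<epsilon>(1)]
    eventually_at_right_less[of 0]
  show "\<forall>\<^sub>F h in at_right 0. ereal M < (INF a\<in>{0..<h}. ereal (stopped_energy r (shifted_grid T h a) w T))"
  proof eventually_elim
    case (elim h)
    \<comment> \<open>The infimum preserves only non-strict bounds, so the bound is shown for
      \<open>N > M\<close>.\<close>
    have "ereal N \<le> (INF a\<in>{0..<h}. ereal (stopped_energy r (shifted_grid T h a) w T))"
    proof (rule INF_greatest)
      fix a assume a: "a \<in> {0..<h}"
      have T: "T \<in> {0..T}" using assms(1) by simp
      have "\<bar>stopped_energy q (shifted_grid T h a) w T - 2 * A\<bar> < A"
        using elim(1)[rule_format, OF a T] by (simp add: A_def)
      then have "A \<le> stopped_energy q (shifted_grid T h a) w T" by linarith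
      also have "\<dots> \<le> \<epsilon> powr (q - r) * stopped_energy r (shifted_grid T h a) w T"
        using elim(2,3) assms(3) a T by (intro stopped_energy_le_exponent) auto
      finally show "ereal N \<le> ereal (stopped_energy r (shifted_grid T h a) w T)"
        using A N unfolding \<epsilon>(2) by (simp add: field_simps)
    qed
    with N(2) show ?case by (simp add: order_less_le_trans[of "ereal M" "ereal N"])
  qed
qed

text \<open>Along the grid with offset 0, the \<open>p\<close>-energy at \<open>T\<close> would stay
  within 1 of its limit and also exceed that limit by more than 1.\<close>

lemma rough_paths_disjoint:
  assumes "0 \<le> T" "p < q" "w \<in> rough_paths q T"
  shows "w \<notin> rough_paths p T"
proof
  assume "w \<in> rough_paths p T"
  note w = rough_pathsD[OF this assms(1)]
  have "\<forall>\<^sub>F h in at_right 0. ereal (intrinsic_energy p T w T + 1)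
      < (INF a\<in>{0..<h}. ereal (stopped_energy p (shifted_grid T h a) w T))"
    using stopped_energy_lower_exponent_tendsto_PInf[OF assms(1,3,2)] unfolding tendsto_PInfty by blast
  from this energy_convergesD[OF w(4) zero_less_one] eventually_at_right_less[of 0]
  have "\<forall>\<^sub>F h in at_right (0::real). False"
  proof eventually_elim
    case (elim h)
    then have "0 \<in> {0..<h}" "T \<in> {0..T}" using assms(1) by auto
    then have "\<bar>stopped_energy p (shifted_grid T h 0) w T - intrinsic_energy p T w T\<bar> < 1"
      using elim(2) by blast
    moreover have "ereal (intrinsic_energy p T w T + 1) < ereal (stopped_energy p (shifted_grid T h 0) w T)"
      using elim(1) INF_lower[OF \<open>0 \<in> {0..<h}\<close>] by (rule order_less_le_trans)
    ultimately show False by simp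
  qed
  then show False by simp
qed

theorem theorem9p3:
  fixes p T :: real
  assumes "p > 1" and "T > 0"
  shows
    "\<comment> \<open>(i)\<close>
    ((\<forall>l\<ge>1. \<forall>m\<ge>1. \<forall>x. continuous_on {0..T} x \<longrightarrow>
        (\<forall>t\<in>{0..T}. rescale (1/p) l (rescale (1/p) m x) t = rescale (1/p) (l * m) x t))
   \<and> (\<forall>l\<ge>1. \<forall>x. continuous_on {0..T} x \<longrightarrow>
        (\<forall>h a. 0 < h \<and> h \<le> T \<and> 0 \<le> a \<and> a < h \<longrightarrow>
          (\<forall>t\<in>{0..T}. stopped_energy p (shifted_grid T h a) (rescale (1/p) l x) t
             = l * stopped_energy p (shifted_grid T (h / l) (a / l)) x (t / l))))
   \<and> (\<forall>l\<ge>1. \<forall>x A. continuous_on {0..T} x \<and> energy_profile T A \<longrightarrow>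
        (\<forall>\<delta>. 0 < \<delta> \<and> \<delta> \<le> T \<longrightarrow>
          energy_modulus p T (rescale_energy l A) (rescale (1/p) l x) \<delta>
            \<le> ereal l * energy_modulus p T A x (\<delta> / l))))
   \<and> \<comment> \<open>(ii)\<close>
    ((\<forall>x\<in>pos_rough_paths p T. \<forall>l\<ge>1.
        rescale (1/p) l x \<in> pos_rough_paths p T
        \<and> (\<forall>t\<in>{0..T}. intrinsic_energy p T (rescale (1/p) l x) t
             = rescale_energy l (intrinsic_energy p T x) t))
   \<and> (\<forall>x\<in>rough_paths p T. \<forall>l\<ge>1.
        (rescale (1/p) l x \<in> rough_paths p T \<longleftrightarrow> intrinsic_energy p T x (T / l) > 0)
        \<and> (intrinsic_energy p T x (T / l) > 0 \<longrightarrow>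
             (\<forall>t\<in>{0..T}. intrinsic_energy p T (rescale (1/p) l x) t
                = rescale_energy l (intrinsic_energy p T x) t))))
   \<and> \<comment> \<open>(iii)\<close>
    ((\<forall>A. energy_profile T A \<longrightarrow>
        ((\<forall>l\<ge>1. \<forall>t\<in>{0..T}. rescale_energy l A t = A t)
          \<longleftrightarrow> (\<forall>t\<in>{0..T}. A t = A T * t / T)))
   \<and> {x \<in> rough_paths p T. \<forall>l\<ge>1. \<forall>t\<in>{0..T}.
          rescale_energy l (intrinsic_energy p T x) t = intrinsic_energy p T x t}
     = {x \<in> rough_paths p T. \<exists>c. \<forall>t\<in>{0..T}. intrinsic_energy p T x t = c * t})
   \<and> \<comment> \<open>(iv)\<close>
    (\<forall>x\<in>rough_paths p T. \<forall>\<alpha>>0.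
        ((\<lambda>s. intrinsic_energy p T x s / s) \<longlongrightarrow> \<alpha>) (at_right 0) \<longrightarrow>
          x \<in> pos_rough_paths p T
          \<and> (\<forall>l\<ge>1. rescale (1/p) l x \<in> pos_rough_paths p T)
          \<and> ((\<lambda>l. SUP t\<in>{0..T}. ereal \<bar>intrinsic_energy p T (rescale (1/p) l x) t - \<alpha> * t\<bar>)
               \<longlongrightarrow> 0) at_top)
   \<and> \<comment> \<open>(v)\<close>
    (\<forall>x\<in>rough_paths p T. \<forall>\<alpha>>0.
        ((\<lambda>s. intrinsic_energy p T x s / s) \<longlongrightarrow> \<alpha>) (at_right 0) \<longrightarrow>
          (\<forall>\<gamma>>0.
             (\<forall>l\<ge>1. rescale \<gamma> l x \<in> rough_paths p T
                \<and> (\<forall>t\<in>{0..T}. intrinsic_energy p T (rescale \<gamma> l x) t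
                     = l powr (\<gamma> * p - 1) * rescale_energy l (intrinsic_energy p T x) t))
             \<and> (\<gamma> = 1/p \<longrightarrow>
                  uniform_limit {0..T} (\<lambda>l. intrinsic_energy p T (rescale \<gamma> l x)) (\<lambda>t. \<alpha> * t) at_top)
             \<and> (\<gamma> < 1/p \<longrightarrow>
                  uniform_limit {0..T} (\<lambda>l. intrinsic_energy p T (rescale \<gamma> l x)) (\<lambda>t. 0) at_top)
             \<and> (\<gamma> > 1/p \<longrightarrow>
                  (\<forall>t\<in>{0<..T}. filterlim (\<lambda>l. intrinsic_energy p T (rescale \<gamma> l x) t) at_top at_top))))
   \<and> \<comment> \<open>(vi)(a)\<close>
    (\<forall>x\<in>rough_paths p T. \<forall>z. continuous_on {0..T} z \<longrightarrow>
        (\<forall>\<beta>. 1/p < \<beta> \<and> \<beta> \<le> 1 \<and> hoelder_const T \<beta> z < \<infinity> \<longrightarrow>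
          (\<forall>l\<ge>1. \<forall>\<delta>. 0 < \<delta> \<and> \<delta> \<le> T \<longrightarrow>
             (SUP h\<in>{0<..\<delta>}. SUP a\<in>{0..<h}. SUP t\<in>{0..T}.
                ereal (stopped_energy p (shifted_grid T h a) (rescale (1/p) l z) t))
             \<le> ereal (real_of_ereal (hoelder_const T \<beta> z) powr p * (T + 2 * \<delta>)
                        * \<delta> powr (\<beta> * p - 1) * l powr (1 - \<beta> * p)))
          \<and> (\<lambda>t. x t + z t) \<in> rough_paths p T
          \<and> (\<forall>t\<in>{0..T}. intrinsic_energy p T (\<lambda>t. x t + z t) t = intrinsic_energy p T x t)))
   \<and> \<comment> \<open>(vi)(b)\<close>
    (\<forall>x\<in>rough_paths p T. \<forall>q>p. \<forall>z\<in>rough_paths q T.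
        (\<lambda>t. x t + z t) \<in> rough_paths q T
        \<and> (\<forall>t\<in>{0..T}. intrinsic_energy q T (\<lambda>t. x t + z t) t = intrinsic_energy q T z t)
        \<and> (\<forall>p'. 1 < p' \<and> p' < q \<longrightarrow>
             ((\<lambda>h. INF a\<in>{0..<h}.
                 ereal (stopped_energy p' (shifted_grid T h a) (\<lambda>t. x t + z t) T))
               \<longlongrightarrow> \<infinity>) (at_right 0))
        \<and> (\<lambda>t. x t + z t) \<notin> rough_paths p T)"
proof (intro conjI)
  have T: "0 \<le> T" and p: "0 < p" "p \<noteq> 0" using assms by auto

  \<comment> \<open>Semigroup law and scaling of energies and moduli\<close>
  show "\<forall>l\<ge>1. \<forall>m\<ge>1. \<forall>x. continuous_on {0..T} x \<longrightarrow>
      (\<forall>t\<in>{0..T}. rescale (1/p) l (rescale (1/p) m x) t = rescale (1/p) (l * m) x t)"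
    by (simp add: rescale_rescale)
  show "\<forall>l\<ge>1. \<forall>x. continuous_on {0..T} x \<longrightarrow>
      (\<forall>h a. 0 < h \<and> h \<le> T \<and> 0 \<le> a \<and> a < h \<longrightarrow>
        (\<forall>t\<in>{0..T}. stopped_energy p (shifted_grid T h a) (rescale (1/p) l x) t
           = l * stopped_energy p (shifted_grid T (h / l) (a / l)) x (t / l)))"
  proof (intro allI impI ballI)
    fix l x h a t
    assume *: "(1::real) \<le> l" "0 < h \<and> h \<le> T \<and> 0 \<le> a \<and> a < h" "t \<in> {0..T}"
    then show "stopped_energy p (shifted_grid T h a) (rescale (1/p) l x) t
        = l * stopped_energy p (shifted_grid T (h / l) (a / l)) x (t / l)"
      using divide_in_interval[OF *(3,1)] p by (intro stopped_energy_rescale) auto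
  qed
  show "\<forall>l\<ge>1. \<forall>x A. continuous_on {0..T} x \<and> energy_profile T A \<longrightarrow>
      (\<forall>\<delta>. 0 < \<delta> \<and> \<delta> \<le> T \<longrightarrow>
        energy_modulus p T (rescale_energy l A) (rescale (1/p) l x) \<delta>
          \<le> ereal l * energy_modulus p T A x (\<delta> / l))"
    using energy_modulus_rescale_le[OF p(2)] by blast

  \<comment> \<open>Intrinsic energies of rescaled rough paths\<close>
  show "\<forall>x\<in>pos_rough_paths p T. \<forall>l\<ge>1. rescale (1/p) l x \<in> pos_rough_paths p T
      \<and> (\<forall>t\<in>{0..T}. intrinsic_energy p T (rescale (1/p) l x) t
           = rescale_energy l (intrinsic_energy p T x) t)"
    using rescale_pos_rough_path[OF p(2) assms(2)] by blast
  show "\<forall>x\<in>rough_paths p T. \<forall>l\<ge>1.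
      (rescale (1/p) l x \<in> rough_paths p T \<longleftrightarrow> intrinsic_energy p T x (T / l) > 0)
      \<and> (intrinsic_energy p T x (T / l) > 0 \<longrightarrow>
           (\<forall>t\<in>{0..T}. intrinsic_energy p T (rescale (1/p) l x) t
              = rescale_energy l (intrinsic_energy p T x) t))"
    using rescale_rough_path_iff[OF p(2) T] by blast

  \<comment> \<open>Energies invariant under the flow\<close>
  show inv: "\<forall>A. energy_profile T A \<longrightarrow>
      ((\<forall>l\<ge>1. \<forall>t\<in>{0..T}. rescale_energy l A t = A t) \<longleftrightarrow> (\<forall>t\<in>{0..T}. A t = A T * t / T))"
  proof (intro allI impI)
    fix A assume "energy_profile T A"
    then have "A 0 = 0" by (simp add: energy_profile_def)
    then show "(\<forall>l\<ge>1. \<forall>t\<in>{0..T}. rescale_energy l A t = A t) \<longleftrightarrow> (\<forall>t\<in>{0..T}. A t = A T * t / T)"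
      by (rule rescale_energy_invariant_iff[OF assms(2)])
  qed
  have lin: "(\<forall>l\<ge>1. \<forall>t\<in>{0..T}. rescale_energy l (intrinsic_energy p T x) t = intrinsic_energy p T x t)
      \<longleftrightarrow> (\<exists>c. \<forall>t\<in>{0..T}. intrinsic_energy p T x t = c * t)" if x: "x \<in> rough_paths p T" for x
  proof -
    let ?A = "intrinsic_energy p T x"
    \<comment> \<open>The slope of a linear energy is determined by its value at
      \<open>T\<close>.\<close>
    have "(\<forall>t\<in>{0..T}. ?A t = ?A T * t / T) \<longleftrightarrow> (\<exists>c. \<forall>t\<in>{0..T}. ?A t = c * t)"
    proof
      assume "\<forall>t\<in>{0..T}. ?A t = ?A T * t / T"
      then show "\<exists>c. \<forall>t\<in>{0..T}. ?A t = c * t"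
        by (intro exI[of _ "?A T / T"]) (simp only: times_divide_eq_left)
    next
      assume "\<exists>c. \<forall>t\<in>{0..T}. ?A t = c * t"
      then obtain c where c: "\<forall>t\<in>{0..T}. ?A t = c * t" ..
      then have "?A T = c * T" using T by simp
      with c show "\<forall>t\<in>{0..T}. ?A t = ?A T * t / T" using assms(2) by simp
    qed
    with inv[rule_format, OF rough_pathsD(2)[OF x T]]
    show ?thesis
      by (rule trans)
  qed
  show "{x \<in> rough_paths p T. \<forall>l\<ge>1. \<forall>t\<in>{0..T}.
        rescale_energy l (intrinsic_energy p T x) t = intrinsic_energy p T x t}
      = {x \<in> rough_paths p T. \<exists>c. \<forall>t\<in>{0..T}. intrinsic_energy p T x t = c * t}"
    by (rule Collect_cong) (use lin in blast)

  \<comment> \<open>Convergence of the flow to the tangent of the energy at time 0\<close>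
  show "\<forall>x\<in>rough_paths p T. \<forall>\<alpha>>0.
      ((\<lambda>s. intrinsic_energy p T x s / s) \<longlongrightarrow> \<alpha>) (at_right 0) \<longrightarrow>
        x \<in> pos_rough_paths p T
        \<and> (\<forall>l\<ge>1. rescale (1/p) l x \<in> pos_rough_paths p T)
        \<and> ((\<lambda>l. SUP t\<in>{0..T}. ereal \<bar>intrinsic_energy p T (rescale (1/p) l x) t - \<alpha> * t\<bar>)
             \<longlongrightarrow> 0) at_top"
  proof (intro ballI allI impI)
    fix x \<alpha>
    let ?A = "intrinsic_energy p T x"
    let ?B = "\<lambda>l. intrinsic_energy p T (rescale (1/p) l x)"
    assume x: "x \<in> rough_paths p T" and \<alpha>: "0 < \<alpha>" and lim: "((\<lambda>s. ?A s / s) \<longlongrightarrow> \<alpha>) (at_right 0)"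
    note A = rough_pathsD(2)[OF x T]
    have x_pos: "x \<in> pos_rough_paths p T"
      using x energy_profile_pos[OF A \<alpha> lim] by (simp add: pos_rough_paths_def)
    note R = rescale_pos_rough_path[OF p(2) assms(2) x_pos]
    have "((\<lambda>l. SUP t\<in>{0..T}. ereal \<bar>?B l t - \<alpha> * t\<bar>) \<longlongrightarrow> 0) at_top"
    proof (rule tendsto_0_ereal_nonneg)
      have "0 \<le> (SUP t\<in>{0..T}. ereal \<bar>?B l t - \<alpha> * t\<bar>)" for l
        by (rule SUP_upper2[of 0]) (use T in auto)
      then show "\<forall>\<^sub>F l in at_top. 0 \<le> (SUP t\<in>{0..T}. ereal \<bar>?B l t - \<alpha> * t\<bar>)" by simp
      fix e :: real assume "0 < e"
      have "?A 0 = 0" using A by (simp add: energy_profile_def)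
      from uniform_limitD[OF rescale_energy_uniform_limit[OF assms(2) this lim] \<open>0 < e\<close>]
        eventually_ge_at_top[of 1]
      show "\<forall>\<^sub>F l in at_top. (SUP t\<in>{0..T}. ereal \<bar>?B l t - \<alpha> * t\<bar>) \<le> ereal e"
      proof eventually_elim
        case (elim l)
        then show ?case
          using R(2)[of l] by (intro SUP_least) (auto simp: dist_real_def intro: less_imp_le)
      qed
    qed
    with x_pos R(1) show "x \<in> pos_rough_paths p T
        \<and> (\<forall>l\<ge>1. rescale (1/p) l x \<in> pos_rough_paths p T)
        \<and> ((\<lambda>l. SUP t\<in>{0..T}. ereal \<bar>?B l t - \<alpha> * t\<bar>) \<longlongrightarrow> 0) at_top" by blast
  qed

  \<comment> \<open>General scaling exponents\<close>
  show "\<forall>x\<in>rough_paths p T. \<forall>\<alpha>>0.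
      ((\<lambda>s. intrinsic_energy p T x s / s) \<longlongrightarrow> \<alpha>) (at_right 0) \<longrightarrow>
        (\<forall>\<gamma>>0.
           (\<forall>l\<ge>1. rescale \<gamma> l x \<in> rough_paths p T
              \<and> (\<forall>t\<in>{0..T}. intrinsic_energy p T (rescale \<gamma> l x) t
                   = l powr (\<gamma> * p - 1) * rescale_energy l (intrinsic_energy p T x) t))
           \<and> (\<gamma> = 1/p \<longrightarrow>
                uniform_limit {0..T} (\<lambda>l. intrinsic_energy p T (rescale \<gamma> l x)) (\<lambda>t. \<alpha> * t) at_top)
           \<and> (\<gamma> < 1/p \<longrightarrow>
                uniform_limit {0..T} (\<lambda>l. intrinsic_energy p T (rescale \<gamma> l x)) (\<lambda>t. 0) at_top)
           \<and> (\<gamma> > 1/p \<longrightarrow>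
                (\<forall>t\<in>{0<..T}. filterlim (\<lambda>l. intrinsic_energy p T (rescale \<gamma> l x) t) at_top at_top)))"
  proof (rule ballI, rule allI, rule impI, rule impI, rule allI, rule impI)
    fix x \<alpha> and \<gamma> :: real
    let ?A = "intrinsic_energy p T x"
    let ?B = "\<lambda>l. intrinsic_energy p T (rescale \<gamma> l x)"
    assume x: "x \<in> rough_paths p T" and \<alpha>: "0 < \<alpha>" and lim: "((\<lambda>s. ?A s / s) \<longlongrightarrow> \<alpha>) (at_right 0)"
    note A = rough_pathsD(2)[OF x T]
    have A0: "?A 0 = 0" using A by (simp add: energy_profile_def)
    have pos: "0 < ?A (T / l)" if "1 \<le> l" for l
      using divide_in_interval[of T T l] that assms(2) by (intro energy_profile_pos[OF A \<alpha> lim]) auto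
    note R = rescale_rough_path_general[OF p(1) assms(2) x _ pos]
    \<comment> \<open>The formula for the energy is available for \<open>l \<ge> 1\<close>; the
      limits are transferred along this eventual equality.\<close>
    have ev: "\<forall>\<^sub>F l in at_top. \<forall>t\<in>{0..T}. ?B l t = l powr (\<gamma> * p - 1) * rescale_energy l ?A t"
      using eventually_ge_at_top[of 1] by (rule eventually_mono) (use R(2) in blast)
    show "(\<forall>l\<ge>1. rescale \<gamma> l x \<in> rough_paths p T
            \<and> (\<forall>t\<in>{0..T}. ?B l t = l powr (\<gamma> * p - 1) * rescale_energy l ?A t))
        \<and> (\<gamma> = 1/p \<longrightarrow> uniform_limit {0..T} ?B (\<lambda>t. \<alpha> * t) at_top)
        \<and> (\<gamma> < 1/p \<longrightarrow> uniform_limit {0..T} ?B (\<lambda>t. 0) at_top)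
        \<and> (\<gamma> > 1/p \<longrightarrow> (\<forall>t\<in>{0<..T}. filterlim (\<lambda>l. ?B l t) at_top at_top))"
    proof (intro conjI impI ballI)
      show "\<forall>l\<ge>1. rescale \<gamma> l x \<in> rough_paths p T
            \<and> (\<forall>t\<in>{0..T}. ?B l t = l powr (\<gamma> * p - 1) * rescale_energy l ?A t)"
        using R by blast
    next
      assume "\<gamma> = 1/p"
      then have r: "\<gamma> * p - 1 = 0" using p by simp
      \<comment> \<open>The factor \<open>l powr 0\<close> equals 1 only for nonzero
        \<open>l\<close>.\<close>
      from ev eventually_gt_at_top[of 0]
      have "\<forall>\<^sub>F l in at_top. \<forall>t\<in>{0..T}. rescale_energy l ?A t = ?B l t"
        by eventually_elim (simp add: r)
      then show "uniform_limit {0..T} ?B (\<lambda>t. \<alpha> * t) at_top"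
        using rescale_energy_uniform_limit[OF assms(2) A0 lim]
        by (subst uniform_limit_cong[symmetric]) auto
    next
      assume "\<gamma> < 1/p"
      then have "\<gamma> * p - 1 < 0" using p by (simp add: field_simps)
      with powr_rescale_energy_uniform_limit_0[OF assms(2) _ A0 lim] \<alpha>
      have "uniform_limit {0..T} (\<lambda>l t. l powr (\<gamma> * p - 1) * rescale_energy l ?A t) (\<lambda>t. 0) at_top"
        by simp
      then show "uniform_limit {0..T} ?B (\<lambda>t. 0) at_top"
        using ev by (subst uniform_limit_cong) auto
    next
      fix t assume "1/p < \<gamma>" and t: "t \<in> {0<..T}"
      then have "0 < \<gamma> * p - 1" using p by (simp add: field_simps)
      with powr_rescale_energy_at_top[OF \<alpha> A0 lim] t
      have "filterlim (\<lambda>l. l powr (\<gamma> * p - 1) * rescale_energy l ?A t) at_top at_top"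
        by simp
      moreover have "\<forall>\<^sub>F l in at_top. ?B l t = l powr (\<gamma> * p - 1) * rescale_energy l ?A t"
        using ev by (rule eventually_mono) (use t in auto)
      ultimately show "filterlim (\<lambda>l. ?B l t) at_top at_top"
        by (subst filterlim_cong[OF refl refl])
    qed
  qed

  \<comment> \<open>Hoelder perturbations\<close>
  show "\<forall>x\<in>rough_paths p T. \<forall>z. continuous_on {0..T} z \<longrightarrow>
      (\<forall>\<beta>. 1/p < \<beta> \<and> \<beta> \<le> 1 \<and> hoelder_const T \<beta> z < \<infinity> \<longrightarrow>
        (\<forall>l\<ge>1. \<forall>\<delta>. 0 < \<delta> \<and> \<delta> \<le> T \<longrightarrow>
           (SUP h\<in>{0<..\<delta>}. SUP a\<in>{0..<h}. SUP t\<in>{0..T}.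
              ereal (stopped_energy p (shifted_grid T h a) (rescale (1/p) l z) t))
           \<le> ereal (real_of_ereal (hoelder_const T \<beta> z) powr p * (T + 2 * \<delta>)
                      * \<delta> powr (\<beta> * p - 1) * l powr (1 - \<beta> * p)))
        \<and> (\<lambda>t. x t + z t) \<in> rough_paths p T
        \<and> (\<forall>t\<in>{0..T}. intrinsic_energy p T (\<lambda>t. x t + z t) t = intrinsic_energy p T x t))"
  proof (rule ballI, rule allI, rule impI, rule allI, rule impI)
    fix x z \<beta>
    assume x: "x \<in> rough_paths p T" and z: "continuous_on {0..T} z"
      and \<beta>: "1/p < \<beta> \<and> \<beta> \<le> 1 \<and> hoelder_const T \<beta> z < \<infinity>"
    have \<beta>p: "1 < \<beta> * p" using \<beta> p by (simp add: field_simps)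
    note H = hoelder_const_bound[OF assms(2), of \<beta> z]
    have K: "0 \<le> real_of_ereal (hoelder_const T \<beta> z)" using H(1) \<beta> by blast
    have hoelder: "\<bar>z u - z s\<bar> \<le> real_of_ereal (hoelder_const T \<beta> z) * \<bar>u - s\<bar> powr \<beta>"
      if "s \<in> {0..T}" "u \<in> {0..T}" for s u using H(2) \<beta> that by blast
    have "(SUP h\<in>{0<..\<delta>}. SUP a\<in>{0..<h}. SUP t\<in>{0..T}.
            ereal (stopped_energy p (shifted_grid T h a) (rescale (1/p) l z) t))
          \<le> ereal (real_of_ereal (hoelder_const T \<beta> z) powr p * (T + 2 * \<delta>)
                    * \<delta> powr (\<beta> * p - 1) * l powr (1 - \<beta> * p))" if "1 \<le> l" for l \<delta>
      by (intro SUP_least ereal_less_eq(3)[THEN iffD2]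
          stopped_energy_rescale_hoelder_le[OF assms(2) p(1) \<beta>p K that _ _ _ _ hoelder]) auto
    moreover note rough_path_add_negligible[OF assms(1) T x z
        energy_converges_0_hoelder[OF p(1) K \<beta>p hoelder]]
    ultimately show "(\<forall>l\<ge>1. \<forall>\<delta>. 0 < \<delta> \<and> \<delta> \<le> T \<longrightarrow>
           (SUP h\<in>{0<..\<delta>}. SUP a\<in>{0..<h}. SUP t\<in>{0..T}.
              ereal (stopped_energy p (shifted_grid T h a) (rescale (1/p) l z) t))
           \<le> ereal (real_of_ereal (hoelder_const T \<beta> z) powr p * (T + 2 * \<delta>)
                      * \<delta> powr (\<beta> * p - 1) * l powr (1 - \<beta> * p)))
        \<and> (\<lambda>t. x t + z t) \<in> rough_paths p T
        \<and> (\<forall>t\<in>{0..T}. intrinsic_energy p T (\<lambda>t. x t + z t) t = intrinsic_energy p T x t)"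
      by blast
  qed

  \<comment> \<open>Sums of rough paths with different exponents\<close>
  show "\<forall>x\<in>rough_paths p T. \<forall>q>p. \<forall>z\<in>rough_paths q T.
      (\<lambda>t. x t + z t) \<in> rough_paths q T
      \<and> (\<forall>t\<in>{0..T}. intrinsic_energy q T (\<lambda>t. x t + z t) t = intrinsic_energy q T z t)
      \<and> (\<forall>p'. 1 < p' \<and> p' < q \<longrightarrow>
           ((\<lambda>h. INF a\<in>{0..<h}.
               ereal (stopped_energy p' (shifted_grid T h a) (\<lambda>t. x t + z t) T))
             \<longlongrightarrow> \<infinity>) (at_right 0))
      \<and> (\<lambda>t. x t + z t) \<notin> rough_paths p T"
  proof (intro ballI allI impI)
    fix x q z assume x: "x \<in> rough_paths p T" and q: "p < q" and z: "z \<in> rough_paths q T"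
    note D = rough_pathsD[OF x T]
    \<comment> \<open>At exponent \<open>q\<close> the roles are exchanged: \<open>x\<close> is the
      negligible perturbation of \<open>z\<close>, so the sum first appears as
      \<open>z + x\<close>.\<close>
    have "energy_converges q T (\<lambda>_. 0) x"
      by (rule energy_converges_0_higher_exponent[OF D(4,1) q energy_profile_bound[OF D(2)]])
    then have S: "(\<lambda>t. z t + x t) \<in> rough_paths q T"
      "\<And>t. t \<in> {0..T} \<Longrightarrow> intrinsic_energy q T (\<lambda>t. z t + x t) t = intrinsic_energy q T z t"
      using rough_path_add_negligible[of q T z x] assms(1) q T z D(1) by auto
    have "(\<lambda>t. z t + x t) = (\<lambda>t. x t + z t)" by (simp add: add.commute)
    note S = S[unfolded this]
    show "(\<lambda>t. x t + z t) \<in> rough_paths q T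
      \<and> (\<forall>t\<in>{0..T}. intrinsic_energy q T (\<lambda>t. x t + z t) t = intrinsic_energy q T z t)
      \<and> (\<forall>p'. 1 < p' \<and> p' < q \<longrightarrow>
           ((\<lambda>h. INF a\<in>{0..<h}.
               ereal (stopped_energy p' (shifted_grid T h a) (\<lambda>t. x t + z t) T))
             \<longlongrightarrow> \<infinity>) (at_right 0))
      \<and> (\<lambda>t. x t + z t) \<notin> rough_paths p T"
      using S stopped_energy_lower_exponent_tendsto_PInf[OF T S(1)] rough_paths_disjoint[OF T q S(1)]
      by blast
  qed
qed

end
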